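(* (1) The map $\lambda\mapsto L(\lambda)$ induces a bijection between $X^+(\infty)$ and the set of isomorphism classes of irreducible $\mathbf U(\infty)$-modules in the category $\mathcal C^{int}\cap\mathcal C^{hi}$. (2) The map $\lambda\mapsto L(\lambda)$ induces a bijection between $X^+(\infty)$ and the set of isomorphism classes of irreducible $\mathbf U(\infty)$-modules in the category $\mathcal C^{int}\cap\mathcal O$.
   Context: $v$ indeterminate. $\mathbf U(\infty)$ is the $\mathbb Q(v)$-algebra with generators $E_i,F_i,K_i,K_i^{-1}$ ($i\in\mathbb Z$) and relations: $K_iK_j=K_jK_i$, $K_iK_i^{-1}=1$; $K_iE_j=v^{\delta_{i,j}-\delta_{i,j+1}}E_jK_i$; $K_iF_j=v^{\delta_{i,j+1}-\delta_{i,j}}F_jK_i$; $E_iE_j=E_jE_i$, $F_iF_j=F_jF_i$ if $|i-j|>1$; $E_iF_j-F_jE_i=\delta_{i,j}\frac{\widetilde K_i-\widetilde K_i^{-1}}{v-v^{-1}}$, $\widetilde K_i=K_iK_{i+1}^{-1}$; $E_i^2E_j-(v+v^{-1})E_iE_jE_i+E_jE_i^2=0$ and likewise for $F$ if $|i-j|=1$. $X(\infty)$ is the set of all integer sequences $\lambda=(\lambda_i)_{i\in\mathbb Z}$; $X^+(\infty)=\{\lambda\in X(\infty):\lambda_i\ge\lambda_{i+1}\ \forall i\}$. $\alpha_i=\varepsilon_i-\varepsilon_{i+1}$; $\mu\le_{wt}\lambda$ iff $\lambda-\mu$ is a finite $\mathbb N$-combination of the $\alpha_i$; $(-\infty,\lambda]=\{\mu:\mu\le_{wt}\lambda\}$.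 For a $\mathbf U(\infty)$-module $M$, $M_\lambda=\{x:K_ix=v^{\lambda_i}x\ \forall i\}$, $\mathrm{wt}(M)=\{\lambda:M_\lambda\ne0\}$; weight module: $M=\bigoplus_\lambda M_\lambda$. $\mathcal C^{int}$: weight modules such that for all $x\in M$, $i\in\mathbb Z$ there is $n_0$ with $E_i^nx=F_i^nx=0$ for all $n\ge n_0$. $\mathcal C^{hi}$: weight modules such that for each $x$ there is $n_0$ with $ux=0$ for all monomials $u$ in the $E_i$'s with at least $n_0$ factors. $\mathcal O$: weight modules with finite-dimensional weight spaces such that $\mathrm{wt}(M)\subseteq\bigcup_{k=1}^s(-\infty,\lambda^{(k)}]$ for some finitely many $\lambda^{(k)}\in X(\infty)$. The Verma module $M(\lambda)=\mathbf U(\infty)/(\sum_i\mathbf U(\infty)E_i+\sum_i\mathbf U(\infty)(K_i-v^{\lambda_i}))$ has a unique maximal submodule; $L(\lambda)$ is its irreducible quotient. All categories are full subcategories of $\mathbf U(\infty)$-modules. *)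

theory Defs
  imports "HOL-Computational_Algebra.Polynomial" "HOL-Computational_Algebra.Fraction_Field"
begin

type_synonym qv = "rat poly fract"

definition vq :: qv where "vq = Fract [:0, 1:] 1"

datatype gen = E int | F int | K int | Kinv int

type_synonym weight = "int \<Rightarrow> int"

definition dlt :: "int \<Rightarrow> int \<Rightarrow> int" where
  "dlt i j = (if i = j then 1 else 0)"

text \<open>A relation is a formal Q(v)-linear combination of words in the generators;
  a word [g1,...,gn] stands for the monomial g1 g2 ... gn.  Each relation r stands for r = 0.\<close>

type_synonym rel = "(qv \<times> gen list) list"

definition RELS :: "rel set" where
  "RELS =
     {[(1, [K i, K j]), (-1, [K j, K i])] | i j. True}
   \<union> {[(1, [K i, Kinv i]), (-1, [])] | i. True}
   \<union> {[(1, [Kinv i, K i]), (-1, [])] | i. True}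
   \<union> {[(1, [K i, E j]), (- (vq powi (dlt i j - dlt i (j+1))), [E j, K i])] | i j. True}
   \<union> {[(1, [K i, F j]), (- (vq powi (dlt i (j+1) - dlt i j)), [F j, K i])] | i j. True}
   \<union> {[(1, [E i, E j]), (-1, [E j, E i])] | i j. \<bar>i - j\<bar> > 1}
   \<union> {[(1, [F i, F j]), (-1, [F j, F i])] | i j. \<bar>i - j\<bar> > 1}
   \<union> {[(1, [E i, F j]), (-1, [F j, E i])] | i j. i \<noteq> j}
   \<union> {[(1, [E i, F i]), (-1, [F i, E i]),
        (- inverse (vq - inverse vq), [K i, Kinv (i+1)]),
        (inverse (vq - inverse vq), [Kinv i, K (i+1)])] | i. True}
   \<union> {[(1, [E i, E i, E j]), (- (vq + inverse vq), [E i, E j, E i]), (1, [E j, E i, E i])]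
        | i j. \<bar>i - j\<bar> = 1}
   \<union> {[(1, [F i, F i, F j]), (- (vq + inverse vq), [F i, F j, F i]), (1, [F j, F i, F i])]
        | i j. \<bar>i - j\<bar> = 1}"

record 'm umod =
  carr  :: "'m set"
  mzero :: 'm
  madd  :: "'m \<Rightarrow> 'm \<Rightarrow> 'm"
  msmul :: "qv \<Rightarrow> 'm \<Rightarrow> 'm"
  mact  :: "gen \<Rightarrow> 'm \<Rightarrow> 'm"

definition acts :: "'m umod \<Rightarrow> gen list \<Rightarrow> 'm \<Rightarrow> 'm" where
  "acts M u x = foldr (mact M) u x"

definition msum :: "'m umod \<Rightarrow> 'm list \<Rightarrow> 'm" where
  "msum M xs = foldr (madd M) xs (mzero M)"

definition opr :: "'m umod \<Rightarrow> rel \<Rightarrow> 'm \<Rightarrow> 'm" where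
  "opr M r x = msum M (map (\<lambda>(c, u). msmul M c (acts M u x)) r)"

definition is_umod :: "'m umod \<Rightarrow> bool" where
  "is_umod M \<longleftrightarrow>
     mzero M \<in> carr M
   \<and> (\<forall>x\<in>carr M. \<forall>y\<in>carr M. madd M x y \<in> carr M)
   \<and> (\<forall>c. \<forall>x\<in>carr M. msmul M c x \<in> carr M)
   \<and> (\<forall>g. \<forall>x\<in>carr M. mact M g x \<in> carr M)
   \<and> (\<forall>x\<in>carr M. \<forall>y\<in>carr M. \<forall>z\<in>carr M. madd M (madd M x y) z = madd M x (madd M y z))
   \<and> (\<forall>x\<in>carr M. \<forall>y\<in>carr M. madd M x y = madd M y x)
   \<and> (\<forall>x\<in>carr M. madd M (mzero M) x = x)
   \<and> (\<forall>x\<in>carr M. \<exists>y\<in>carr M. madd M x y = mzero M)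
   \<and> (\<forall>c. \<forall>x\<in>carr M. \<forall>y\<in>carr M. msmul M c (madd M x y) = madd M (msmul M c x) (msmul M c y))
   \<and> (\<forall>c d. \<forall>x\<in>carr M. msmul M (c + d) x = madd M (msmul M c x) (msmul M d x))
   \<and> (\<forall>c d. \<forall>x\<in>carr M. msmul M (c * d) x = msmul M c (msmul M d x))
   \<and> (\<forall>x\<in>carr M. msmul M 1 x = x)
   \<and> (\<forall>g. \<forall>x\<in>carr M. \<forall>y\<in>carr M. mact M g (madd M x y) = madd M (mact M g x) (mact M g y))
   \<and> (\<forall>g c. \<forall>x\<in>carr M. mact M g (msmul M c x) = msmul M c (mact M g x))
   \<and> (\<forall>r\<in>RELS. \<forall>x\<in>carr M. opr M r x = mzero M)"

definition is_submod :: "'m umod \<Rightarrow> 'm set \<Rightarrow> bool" where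
  "is_submod M S \<longleftrightarrow> S \<subseteq> carr M \<and> mzero M \<in> S
     \<and> (\<forall>x\<in>S. \<forall>y\<in>S. madd M x y \<in> S)
     \<and> (\<forall>c. \<forall>x\<in>S. msmul M c x \<in> S)
     \<and> (\<forall>g. \<forall>x\<in>S. mact M g x \<in> S)"

definition umod_irreducible :: "'m umod \<Rightarrow> bool" where
  "umod_irreducible M \<longleftrightarrow> carr M \<noteq> {mzero M}
     \<and> (\<forall>S. is_submod M S \<longrightarrow> S = {mzero M} \<or> S = carr M)"

definition umod_iso :: "'m umod \<Rightarrow> 'n umod \<Rightarrow> bool" where
  "umod_iso M N \<longleftrightarrow> (\<exists>f. bij_betw f (carr M) (carr N)
     \<and> (\<forall>x\<in>carr M. \<forall>y\<in>carr M. f (madd M x y) = madd N (f x) (f y))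
     \<and> (\<forall>c. \<forall>x\<in>carr M. f (msmul M c x) = msmul N c (f x))
     \<and> (\<forall>g. \<forall>x\<in>carr M. f (mact M g x) = mact N g (f x)))"

definition Xplus :: "weight set" where
  "Xplus = {lam. \<forall>i. lam i \<ge> lam (i + 1)}"

text \<open>mu \<le>wt lam iff lam - mu = sum of c_i alpha_i, c finitely supported in N;
  the coefficient of eps_j in sum c_i (eps_i - eps_(i+1)) is c_j - c_(j-1).\<close>
definition wt_le :: "weight \<Rightarrow> weight \<Rightarrow> bool" where
  "wt_le mu lam \<longleftrightarrow> (\<exists>c :: int \<Rightarrow> nat. finite {i. c i \<noteq> 0}
       \<and> (\<forall>j. lam j - mu j = int (c j) - int (c (j - 1))))"

definition wspace :: "'m umod \<Rightarrow> weight \<Rightarrow> 'm set" where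
  "wspace M lam = {x \<in> carr M. \<forall>i. mact M (K i) x = msmul M (vq powi lam i) x}"

definition wts :: "'m umod \<Rightarrow> weight set" where
  "wts M = {lam. \<exists>x\<in>wspace M lam. x \<noteq> mzero M}"

text \<open>Weight module: every vector is a finite sum of weight vectors (the sum is automatically
  direct, since v is not a root of unity).\<close>
definition is_weight_mod :: "'m umod \<Rightarrow> bool" where
  "is_weight_mod M \<longleftrightarrow> (\<forall>x\<in>carr M. \<exists>ps :: (weight \<times> 'm) list.
      (\<forall>(lam, y)\<in>set ps. y \<in> wspace M lam) \<and> x = msum M (map snd ps))"

definition fin_dim :: "'m umod \<Rightarrow> 'm set \<Rightarrow> bool" where
  "fin_dim M W \<longleftrightarrow> (\<exists>bs. set bs \<subseteq> W \<and> (\<forall>x\<in>W. \<exists>cs. length cs = length bs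
      \<and> x = msum M (map2 (msmul M) cs bs)))"

definition Cint :: "'m umod \<Rightarrow> bool" where
  "Cint M \<longleftrightarrow> is_weight_mod M \<and> (\<forall>x\<in>carr M. \<forall>i. \<exists>n0. \<forall>n\<ge>n0.
      acts M (replicate n (E i)) x = mzero M \<and> acts M (replicate n (F i)) x = mzero M)"

definition Chi :: "'m umod \<Rightarrow> bool" where
  "Chi M \<longleftrightarrow> is_weight_mod M \<and> (\<forall>x\<in>carr M. \<exists>n0. \<forall>u.
      set u \<subseteq> range E \<and> length u \<ge> n0 \<longrightarrow> acts M u x = mzero M)"

definition catO :: "'m umod \<Rightarrow> bool" where
  "catO M \<longleftrightarrow> is_weight_mod M \<and> (\<forall>lam. fin_dim M (wspace M lam))
     \<and> (\<exists>ls :: weight list. wts M \<subseteq> {mu. \<exists>lam\<in>set ls. wt_le mu lam})"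

text \<open>The free associative Q(v)-algebra on the generators: finitely supported functions
  from words to Q(v).\<close>

type_synonym falg = "gen list \<Rightarrow> qv"

definition FA :: "falg set" where "FA = {a. finite {w. a w \<noteq> 0}}"

definition fzero :: falg where "fzero = (\<lambda>w. 0)"
definition fone :: falg where "fone = (\<lambda>w. if w = [] then 1 else 0)"
definition fword :: "gen list \<Rightarrow> falg" where "fword u = (\<lambda>w. if w = u then 1 else 0)"
definition fadd :: "falg \<Rightarrow> falg \<Rightarrow> falg" where "fadd a b = (\<lambda>w. a w + b w)"
definition fsmul :: "qv \<Rightarrow> falg \<Rightarrow> falg" where "fsmul c a = (\<lambda>w. c * a w)"
definition fsub :: "falg \<Rightarrow> falg \<Rightarrow> falg" where "fsub a b = (\<lambda>w. a w - b w)"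
definition lgen :: "gen \<Rightarrow> falg \<Rightarrow> falg" where
  "lgen g a = (\<lambda>w. case w of [] \<Rightarrow> 0 | h # t \<Rightarrow> if h = g then a t else 0)"
definition rgen :: "falg \<Rightarrow> gen \<Rightarrow> falg" where
  "rgen a g = (\<lambda>w. if w \<noteq> [] \<and> last w = g then a (butlast w) else 0)"

definition fa_of :: "rel \<Rightarrow> falg" where
  "fa_of r = (\<lambda>w. sum_list (map fst (filter (\<lambda>(c, u). u = w) r)))"

inductive_set lideal :: "falg set \<Rightarrow> falg set" for S where
  base: "a \<in> S \<Longrightarrow> a \<in> lideal S"
| zero: "fzero \<in> lideal S"
| add: "a \<in> lideal S \<Longrightarrow> b \<in> lideal S \<Longrightarrow> fadd a b \<in> lideal S"
| smul: "a \<in> lideal S \<Longrightarrow> fsmul c a \<in> lideal S"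
| lmul: "a \<in> lideal S \<Longrightarrow> lgen g a \<in> lideal S"

inductive_set tideal :: "falg set \<Rightarrow> falg set" for S where
  base: "a \<in> S \<Longrightarrow> a \<in> tideal S"
| zero: "fzero \<in> tideal S"
| add: "a \<in> tideal S \<Longrightarrow> b \<in> tideal S \<Longrightarrow> fadd a b \<in> tideal S"
| smul: "a \<in> tideal S \<Longrightarrow> fsmul c a \<in> tideal S"
| lmul: "a \<in> tideal S \<Longrightarrow> lgen g a \<in> tideal S"
| rmul: "a \<in> tideal S \<Longrightarrow> rgen a g \<in> tideal S"

text \<open>Two-sided ideal of defining relations: U(infinity) = FA / RI.\<close>
definition RI :: "falg set" where "RI = tideal (fa_of ` RELS)"

definition is_lideal :: "falg set \<Rightarrow> bool" where
  "is_lideal J \<longleftrightarrow> J \<subseteq> FA \<and> fzero \<in> J \<and> (\<forall>a\<in>J. \<forall>b\<in>J. fadd a b \<in> J)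
     \<and> (\<forall>c. \<forall>a\<in>J. fsmul c a \<in> J) \<and> (\<forall>g. \<forall>a\<in>J. lgen g a \<in> J)"

text \<open>Preimage in FA of the left ideal defining the Verma module M(lambda).\<close>
definition Verma_ideal :: "weight \<Rightarrow> falg set" where
  "Verma_ideal lam = lideal (RI \<union> range (\<lambda>i. fword [E i])
      \<union> range (\<lambda>i. fsub (fword [K i]) (fsmul (vq powi lam i) fone)))"

text \<open>Preimage of the (unique) maximal submodule of M(lambda): the sum of all proper
  submodules.\<close>
definition Max_ideal :: "weight \<Rightarrow> falg set" where
  "Max_ideal lam = lideal (\<Union> {J. is_lideal J \<and> Verma_ideal lam \<subseteq> J \<and> fone \<notin> J})"

definition Lmod :: "weight \<Rightarrow> falg set umod" where
  "Lmod lam = (let N = Max_ideal lam;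
                   cl = (\<lambda>a. {b \<in> FA. fsub b a \<in> N}) in
     \<lparr> carr = cl ` FA,
       mzero = cl fzero,
       madd = (\<lambda>X Y. {z \<in> FA. \<exists>x\<in>X. \<exists>y\<in>Y. fsub z (fadd x y) \<in> N}),
       msmul = (\<lambda>c X. {z \<in> FA. \<exists>x\<in>X. fsub z (fsmul c x) \<in> N}),
       mact = (\<lambda>g X. {z \<in> FA. \<exists>x\<in>X. fsub z (lgen g x) \<in> N}) \<rparr>)"

end

theory Submission
  imports Defs "HOL-Library.Function_Algebras" "HOL-Algebra.FiniteProduct"
begin

text \<open>The irreducible module of highest weight \<open>lam\<close> is realised concretely inside the functions on
  words \<open>i\<^sub>1 \<dots> i\<^sub>n\<close> of simple roots, i.e. inside the dual of the free algebra on the \<open>F\<^sub>i\<close>: a function \<open>f\<close>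
  records the numbers \<open>f (i\<^sub>1 \<dots> i\<^sub>n)\<close>, the coefficients of the highest weight vector in
  \<open>E\<^bsub>i\<^sub>n\<^esub> \<cdots> E\<^bsub>i\<^sub>1\<^esub> f\<close>.  So \<open>E\<^sub>i\<close> strips a letter, \<open>K\<^sub>i\<close> is diagonal, \<open>F\<^sub>i\<close> is forced by its commutators
  with the \<open>E\<^sub>j\<close>, and the module is what the \<open>F\<^sub>i\<close> generate from the indicator of the empty word.
  A function killed by all \<open>E\<^sub>i\<close> is a multiple of that indicator; this gives irreducibility, the Serre
  relations (a Serre element commutes with the opposite generators), and \<open>F\<^sub>i\<close>-nilpotency for
  dominant \<open>lam\<close>.

  In the free algebra, a proper left ideal containing the Verma ideal annihilates the highest weight
  vector of this model: modulo the Verma ideal each element is a combination of words in the \<open>F\<^sub>i\<close>, and a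
  nonzero coefficient at the empty word can be isolated by the operators \<open>K\<^sub>i - v\<^sup>m\<close>.  Hence the model
  is \<open>L(lam)\<close>, and so is every irreducible module with a primitive vector of weight \<open>lam\<close>.  Such a
  vector exists in \<open>C\<^sup>h\<^sup>i\<close> by definition and in \<open>O\<close> because the height of weights above a given one is
  bounded; its weight is dominant by the usual \<open>sl\<^sub>2\<close> formula for \<open>E\<^sub>i F\<^sub>i\<^sup>n\<close>.\<close>

section \<open>Scalars and linear operators on functions\<close>

lemma vq_power: "vq ^ n = Fract (monom 1 n) 1"
proof (induction n)
  case 0
  show ?case by (simp add: One_fract_def)
next
  case (Suc n)
  have "[:0, 1:] * monom (1::rat) n = monom 1 (Suc n)"
    by (simp add: monom_Suc)
  then show ?case using Suc by (simp add: vq_def)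
qed

lemma vq_nonzero [simp]: "vq \<noteq> 0"
proof -
  have "vq \<noteq> Fract 0 1"
    unfolding vq_def by (simp only: eq_fract) simp
  then show ?thesis by (simp add: Zero_fract_def)
qed

lemma vq_power_eq_1_iff: "vq ^ n = 1 \<longleftrightarrow> n = 0"
proof
  assume "vq ^ n = 1"
  then have "monom (1::rat) n = monom 1 0"
    by (simp add: vq_power One_fract_def eq_fract)
  then show "n = 0" by (metis degree_monom_eq one_neq_zero)
qed simp

lemma vq_powi_eq_1_iff: "vq powi n = 1 \<longleftrightarrow> n = 0"
  by (cases "n \<ge> 0") (auto simp: power_int_def vq_power_eq_1_iff power_inverse)

text \<open>Since \<open>v\<close> is not a root of unity, an eigenvalue \<open>v^m\<close> of
  \<open>K_i\<close> determines the integer \<open>m\<close>. This is what separates weights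
  below.\<close>

lemma vq_powi_eq_iff [simp]: "vq powi m = vq powi n \<longleftrightarrow> m = n"
proof -
  have "vq powi m = vq powi n \<longleftrightarrow> vq powi (m - n) = 1"
    by (auto simp: power_int_diff)
  then show ?thesis by (simp add: vq_powi_eq_1_iff)
qed

lemma vq_neq_inverse [simp]: "vq \<noteq> inverse vq"
  using vq_powi_eq_iff[of 1 "-1"] by (simp add: power_int_minus)

text \<open>The quantum integer \<open>[m] = (v^m - v^(-m)) / (v - v^(-1))\<close>.\<close>

definition qint :: "int \<Rightarrow> qv" where
  "qint m = inverse (vq - inverse vq) * (vq powi m - vq powi (- m))"

lemma qint_0 [simp]: "qint 0 = 0"
  by (simp add: qint_def)

lemma qint_eq_0_iff [simp]: "qint m = 0 \<longleftrightarrow> m = 0"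
  by (simp add: qint_def)

text \<open>On a primitive vector of weight \<open>m\<close> at the simple coroot, \<open>E_i F_i^n\<close> is this multiple of
  \<open>F_i^(n-1)\<close>.\<close>
lemma sum_qint: "(\<Sum>k<n. qint (m - 2 * int k)) = qint (int n) * qint (m - int n + 1)"
proof (induction n)
  case (Suc n)
  \<comment> \<open>In terms of \<open>a = v^n\<close> and \<open>b = v^m\<close> the step from
    \<open>n\<close> to \<open>n + 1\<close> becomes a rational identity in \<open>a\<close>,
    \<open>b\<close> and \<open>v\<close>.\<close>
  define a b where "a = vq powi (int n)" and "b = vq powi m"
  have nz: "a \<noteq> 0" "b \<noteq> 0" by (simp_all add: a_def b_def)
  have e: "vq powi (- int n) = inverse a" "vq powi (m - int n + 1) = b * inverse a * vq"
    "vq powi (- (m - int n + 1)) = a * inverse b * inverse vq"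
    "vq powi (m - 2 * int n) = b * inverse a * inverse a"
    "vq powi (- (m - 2 * int n)) = a * a * inverse b"
    "vq powi (int (Suc n)) = a * vq" "vq powi (- int (Suc n)) = inverse a * inverse vq"
    "vq powi (m - int (Suc n) + 1) = b * inverse a" "vq powi (- (m - int (Suc n) + 1)) = a * inverse b"
    unfolding a_def b_def
    by (simp_all add: power_int_diff power_int_add power_int_minus field_simps power_int_mult power2_eq_square)
  have "qint (int n) * qint (m - int n + 1) + qint (m - 2 * int n)
      = qint (int (Suc n)) * qint (m - int (Suc n) + 1)"
  proof -
    define d where "d = vq - inverse vq"
    have d: "d \<noteq> 0" by (simp add: d_def)
    have "(a - inverse a) * (b * inverse a * vq - a * inverse b * inverse vq)
       + d * (b * inverse a * inverse a - a * a * inverse b)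
       = (a * vq - inverse a * inverse vq) * (b * inverse a - a * inverse b)"
      using nz unfolding d_def by (simp add: field_simps)
    moreover have "inverse d * P * (inverse d * Q) + inverse d * R = inverse d * S * (inverse d * T)"
      if "P * Q + d * R = S * T" for P Q R S T
    proof -
      have "inverse d * P * (inverse d * Q) + inverse d * R = inverse d * inverse d * (P * Q + d * R)"
        using d by (simp add: field_simps)
      then show ?thesis by (simp add: that)
    qed
    ultimately show ?thesis
      unfolding qint_def e d_def[symmetric] a_def[symmetric] by blast
  qed
  then show ?case using Suc by simp
qed simp

definition sc :: "qv \<Rightarrow> ('a \<Rightarrow> qv) \<Rightarrow> 'a \<Rightarrow> qv" where
  "sc c f = (\<lambda>w. c * f w)"

lemma sc_apply: "sc c f w = c * f w"
  by (simp add: sc_def)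

text \<open>Rule induction leaves function arguments eta-expanded; with the pointwise rules in the
  simpset the simplifier would rewrite below these abstractions.\<close>
declare plus_fun_apply [simp del] zero_fun_apply [simp del] minus_apply [simp del] uminus_apply [simp del]

lemmas pw = sc_apply minus_apply uminus_apply plus_fun_apply zero_fun_apply

lemma sc_simps [simp]: "sc 1 f = f" "sc 0 f = 0" "sc c 0 = 0" "sc c (sc d f) = sc (c * d) f"
  by (simp_all add: fun_eq_iff pw)

lemma sc_distrib: "sc c (f + g) = sc c f + sc c g" "sc c (f - g) = sc c f - sc c g"
  "sc (c + d) f = sc c f + sc d f"
  by (simp_all add: fun_eq_iff pw algebra_simps)

lemma sc_neg: "f + sc (- c) g = f - sc c g" "f + sc (- 1) g = f - g"
  by (simp_all add: fun_eq_iff pw)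

definition linop :: "(('a \<Rightarrow> qv) \<Rightarrow> 'b \<Rightarrow> qv) \<Rightarrow> bool" where
  "linop L \<longleftrightarrow> (\<forall>f g. L (f + g) = L f + L g) \<and> (\<forall>c f. L (sc c f) = sc c (L f))"

lemma linopI:
  "(\<And>f g w. L (f + g) w = L f w + L g w) \<Longrightarrow> (\<And>c f w. L (sc c f) w = c * L f w) \<Longrightarrow> linop L"
  by (simp add: linop_def fun_eq_iff pw)

lemma linop_add: "linop L \<Longrightarrow> L (f + g) = L f + L g"
  and linop_sc: "linop L \<Longrightarrow> L (sc c f) = sc c (L f)"
  by (simp_all add: linop_def)

lemma linop_0: assumes "linop L" shows "L 0 = 0"
  using linop_sc[OF assms, of 0 0] by simp

lemma linop_diff: assumes "linop L" shows "L (f - g) = L f - L g"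
proof -
  have "L (f - g) + L g = L f" using linop_add[OF assms, of "f - g" g] by simp
  then show ?thesis by (simp add: algebra_simps)
qed

lemmas linop_simps = linop_add linop_sc linop_0 linop_diff

section \<open>Operators on functions on words\<close>

definition serre :: "(('a \<Rightarrow> qv) \<Rightarrow> 'a \<Rightarrow> qv) \<Rightarrow> (('a \<Rightarrow> qv) \<Rightarrow> 'a \<Rightarrow> qv) \<Rightarrow> ('a \<Rightarrow> qv) \<Rightarrow> 'a \<Rightarrow> qv" where
  "serre X Y f = X (X (Y f)) - sc (vq + inverse vq) (X (Y (X f))) + Y (X (X f))"

text \<open>\<open>Z\<close> is the generator opposite to \<open>X\<close>, and \<open>H\<close>,
  \<open>H'\<close> are the two Cartan terms of their commutator. Moving \<open>H\<close> to the
  right leaves multiples of \<open>X (Y (H f))\<close> and \<open>Y (X (H f))\<close>, whose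
  coefficients cancel by \<open>p + q = v + v^(-1)\<close> and \<open>p q = 1\<close>; likewise for
  \<open>H'\<close>.\<close>

lemma serre_commute_fst:
  assumes lin: "linop X" "linop Y" "linop Z" "linop H" "linop H'"
    and ZX: "\<And>f. Z (X f) = X (Z f) + sc s (H f - H' f)"
    and ZY: "\<And>f. Z (Y f) = Y (Z f)"
    and HX: "\<And>f. H (X f) = sc (q * q) (X (H f))" "\<And>f. H' (X f) = sc (p * p) (X (H' f))"
    and HY: "\<And>f. H (Y f) = sc p (Y (H f))" "\<And>f. H' (Y f) = sc q (Y (H' f))"
    and pq: "p + q = vq + inverse vq" "p * q = 1"
  shows "Z (serre X Y f) = serre X Y (Z f)"
proof (rule ext)
  fix w
  have qqp: "q * (p * x) = x" "p * (q * x) = x" for x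
    using pq(2) by (simp_all add: mult.assoc[symmetric] mult.commute)
  have pq2: "p * q * x = x" "q * p * x = x" for x using pq(2) by (simp_all add: mult.commute)
  show "Z (serre X Y f) w = serre X Y (Z f) w"
    unfolding serre_def pq(1)[symmetric]
    by (simp add: ZX ZY HX HY linop_simps[OF lin(1)] linop_simps[OF lin(2)] linop_simps[OF lin(3)]
        linop_simps[OF lin(4)] linop_simps[OF lin(5)] pw algebra_simps qqp pq2 pq(2))
qed

text \<open>Here \<open>Z\<close> is opposite to \<open>Y\<close>, and the only coefficient left at
  \<open>X (X (H f))\<close> is \<open>1 - (p + q) q + q^2 = 1 - p q = 0\<close>. For
  \<open>H'\<close> the roles of \<open>p\<close> and \<open>q\<close> are exchanged.\<close>

lemma serre_commute_snd:
  assumes lin: "linop X" "linop Y" "linop Z" "linop H" "linop H'"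
    and ZX: "\<And>f. Z (Y f) = Y (Z f) + sc s (H f - H' f)"
    and ZY: "\<And>f. Z (X f) = X (Z f)"
    and HX: "\<And>f. H (X f) = sc q (X (H f))" "\<And>f. H' (X f) = sc p (X (H' f))"
    and pq: "p + q = vq + inverse vq" "p * q = 1"
  shows "Z (serre X Y f) = serre X Y (Z f)"
proof (rule ext)
  fix w
  have qqp: "q * (p * x) = x" "p * (q * x) = x" for x
    using pq(2) by (simp_all add: mult.assoc[symmetric] mult.commute)
  have pq2: "p * q * x = x" "q * p * x = x" for x using pq(2) by (simp_all add: mult.commute)
  show "Z (serre X Y f) w = serre X Y (Z f) w"
    unfolding serre_def pq(1)[symmetric]
    by (simp add: ZX ZY HX linop_simps[OF lin(1)] linop_simps[OF lin(2)] linop_simps[OF lin(3)]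
        linop_simps[OF lin(4)] linop_simps[OF lin(5)] pw algebra_simps qqp pq2 pq(2))
qed

lemma serre_commute:
  assumes "linop X" "linop Y" "linop Z"
    and "\<And>f. Z (X f) = X (Z f)" and "\<And>f. Z (Y f) = Y (Z f)"
  shows "Z (serre X Y f) = serre X Y (Z f)"
  unfolding serre_def by (simp add: assms linop_simps[OF assms(3)])

text \<open>The weight of an \<open>F\<close>-word applied to a vector of weight \<open>lam\<close>:
  each letter subtracts its simple root.\<close>

fun wtw :: "weight \<Rightarrow> int list \<Rightarrow> weight" where
  "wtw lam [] = lam"
| "wtw lam (i # w) = (\<lambda>j. wtw lam w j - dlt j i + dlt j (i + 1))"

definition opK :: "weight \<Rightarrow> int \<Rightarrow> (int list \<Rightarrow> qv) \<Rightarrow> int list \<Rightarrow> qv" where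
  "opK lam j f = (\<lambda>w. vq powi wtw lam w j * f w)"

definition opKi :: "weight \<Rightarrow> int \<Rightarrow> (int list \<Rightarrow> qv) \<Rightarrow> int list \<Rightarrow> qv" where
  "opKi lam j f = (\<lambda>w. vq powi (- wtw lam w j) * f w)"

definition opE :: "int \<Rightarrow> (int list \<Rightarrow> qv) \<Rightarrow> int list \<Rightarrow> qv" where
  "opE i f = (\<lambda>w. f (i # w))"

text \<open>The recursion solves the commutator relation of \<open>E_j\<close> and
  \<open>F_i\<close> for \<open>F_i\<close>, since the value at \<open>j # w\<close> is the value at
  \<open>w\<close> after applying \<open>E_j\<close>. The quantum integer is the eigenvalue of the
  Cartan term on the indicator of \<open>w\<close>; the value at the empty word is 0 because
  \<open>F_i\<close> lowers weights.\<close>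

fun opF :: "weight \<Rightarrow> int \<Rightarrow> (int list \<Rightarrow> qv) \<Rightarrow> int list \<Rightarrow> qv" where
  "opF lam i f [] = 0"
| "opF lam i f (j # w) = opF lam i (opE j f) w
     + (if i = j then qint (wtw lam w i - wtw lam w (i + 1)) * f w else 0)"

lemma opK_apply: "opK lam j f w = vq powi wtw lam w j * f w"
  and opKi_apply: "opKi lam j f w = vq powi (- wtw lam w j) * f w"
  by (simp_all add: opK_def opKi_def)

lemmas opw = pw opK_apply opKi_apply

definition opH :: "weight \<Rightarrow> int \<Rightarrow> (int list \<Rightarrow> qv) \<Rightarrow> int list \<Rightarrow> qv" where
  "opH lam i f = opK lam i (opKi lam (i + 1) f)"
definition opHi :: "weight \<Rightarrow> int \<Rightarrow> (int list \<Rightarrow> qv) \<Rightarrow> int list \<Rightarrow> qv" where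
  "opHi lam i f = opKi lam i (opK lam (i + 1) f)"

lemma linop_opK: "linop (opK lam i)" and linop_opKi: "linop (opKi lam i)"
  and linop_opE: "linop (opE i)"
  and linop_opH: "linop (opH lam i)" and linop_opHi: "linop (opHi lam i)"
  by (auto intro!: linopI simp: opE_def opH_def opHi_def opw algebra_simps)

lemma linop_opF: "linop (opF lam i)"
proof (rule linopI)
  show "opF lam i (f + g) w = opF lam i f w + opF lam i g w" for f g w
    by (induction w arbitrary: f g)
      (auto simp: linop_simps[OF linop_opE] pw algebra_simps)
  show "opF lam i (sc c f) w = c * opF lam i f w" for c f w
    by (induction w arbitrary: f)
      (auto simp: linop_simps[OF linop_opE] pw algebra_simps)
qed

lemmas op_linear = linop_simps[OF linop_opK] linop_simps[OF linop_opKi] linop_simps[OF linop_opE]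
  linop_simps[OF linop_opF] linop_simps[OF linop_opH] linop_simps[OF linop_opHi]

lemma opE_opK: "opE i (opK lam j f) = sc (vq powi (dlt j (i+1) - dlt j i)) (opK lam j (opE i f))"
  and opE_opKi: "opE i (opKi lam j f) = sc (vq powi (dlt j i - dlt j (i+1))) (opKi lam j (opE i f))"
  by (simp_all add: fun_eq_iff opE_def opw algebra_simps flip: power_int_add)

lemma opK_opE: "opK lam j (opE i f) = sc (vq powi (dlt j i - dlt j (i+1))) (opE i (opK lam j f))"
  and opKi_opE: "opKi lam j (opE i f) = sc (vq powi (dlt j (i+1) - dlt j i)) (opE i (opKi lam j f))"
  by (simp_all add: opE_opK opE_opKi flip: power_int_add)

lemma opK_opF: "opK lam j (opF lam i f) = sc (vq powi (dlt j (i+1) - dlt j i)) (opF lam i (opK lam j f))"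
proof (rule ext)
  fix w
  show "opK lam j (opF lam i f) w = sc (vq powi (dlt j (i+1) - dlt j i)) (opF lam i (opK lam j f)) w"
  proof (induction w arbitrary: f)
    case (Cons k w)
    let ?c = "vq powi (dlt j (i+1) - dlt j i)" and ?d = "vq powi (dlt j (k+1) - dlt j k)"
      and ?m = "vq powi wtw lam w j"
    have 1: "vq powi wtw lam (k # w) j = ?d * ?m"
      by (simp add: algebra_simps flip: power_int_add)
    have IH: "?m * opF lam i (opE k f) w = ?c * opF lam i (opK lam j (opE k f)) w"
      using Cons[of "opE k f"] by (simp only: opK_apply[of _ _ "opF _ _ _"] sc_apply)
    have "opK lam j (opF lam i f) (k # w) = ?d * (?m * opF lam i (opE k f) w)
        + (if i = k then ?d * ?m * (qint (wtw lam w i - wtw lam w (i + 1)) * f w) else 0)"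
      by (simp only: opK_apply 1 opF.simps) (simp add: algebra_simps)
    also have "\<dots> = sc ?c (opF lam i (opK lam j f)) (k # w)"
      unfolding IH by (simp add: opE_opK op_linear opw) (simp add: algebra_simps)
    finally show ?case .
  qed (simp add: opw)
qed

lemma opKi_opF: "opKi lam j (opF lam i f) = sc (vq powi (dlt j i - dlt j (i+1))) (opF lam i (opKi lam j f))"
proof -
  have inv: "opKi lam j (opK lam j f) = f" "opK lam j (opKi lam j f) = f" for f
    by (simp_all add: fun_eq_iff opw flip: power_int_add mult.assoc)
  have "opF lam i f = sc (vq powi (dlt j i - dlt j (i+1))) (opK lam j (opF lam i (opKi lam j f)))"
    using opK_opF[of lam j i "opKi lam j f"] by (simp add: inv flip: power_int_add)
  then have "opKi lam j (opF lam i f)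
      = sc (vq powi (dlt j i - dlt j (i+1))) (opKi lam j (opK lam j (opF lam i (opKi lam j f))))"
    by (simp only: op_linear)
  then show ?thesis by (simp only: inv)
qed

text \<open>This is the recursion of \<open>opF\<close> read as a commutator, so it holds for every
  function on words.\<close>

lemma opE_opF: "opE j (opF lam i f)
    = opF lam i (opE j f) + (if i = j then sc (inverse (vq - inverse vq)) (opH lam i f - opHi lam i f) else 0)"
  by (auto simp: fun_eq_iff opE_def opH_def opHi_def opw qint_def power_int_diff power_int_minus algebra_simps
     field_simps)

section \<open>Cartan integers in the commutation rules\<close>

lemma dlt_simps [simp]: "dlt i i = 1" "dlt i (i + 1) = 0" "dlt (i + 1) i = 0" "dlt i (i - 1) = 0"
  "dlt (i - 1) i = 0"
  by (simp_all add: dlt_def)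

definition cartan :: "int \<Rightarrow> int \<Rightarrow> int" where
  "cartan i j = 2 * dlt i j - dlt i (j + 1) - dlt (i + 1) j"

lemma cartan_self [simp]: "cartan i i = 2"
  and cartan_adjacent: "\<bar>i - j\<bar> = 1 \<Longrightarrow> cartan i j = - 1" "\<bar>i - j\<bar> = 1 \<Longrightarrow> cartan j i = - 1"
  and cartan_far: "\<bar>i - j\<bar> > 1 \<Longrightarrow> cartan i j = 0" "\<bar>i - j\<bar> > 1 \<Longrightarrow> cartan j i = 0"
  by (auto simp: cartan_def dlt_def)

lemma opH_opE: "opH lam j (opE i f) = sc (vq powi (cartan j i)) (opE i (opH lam j f))"
  and opHi_opE: "opHi lam j (opE i f) = sc (vq powi (- cartan j i)) (opE i (opHi lam j f))"
  and opH_opF: "opH lam j (opF lam i f) = sc (vq powi (- cartan j i)) (opF lam i (opH lam j f))"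
  and opHi_opF: "opHi lam j (opF lam i f) = sc (vq powi (cartan j i)) (opF lam i (opHi lam j f))"
proof -
  have d: "dlt (j + 1) (i + 1) = dlt j i" by (simp add: dlt_def)
  show "opH lam j (opE i f) = sc (vq powi (cartan j i)) (opE i (opH lam j f))"
   "opHi lam j (opE i f) = sc (vq powi (- cartan j i)) (opE i (opHi lam j f))"
   "opH lam j (opF lam i f) = sc (vq powi (- cartan j i)) (opF lam i (opH lam j f))"
   "opHi lam j (opF lam i f) = sc (vq powi (cartan j i)) (opF lam i (opHi lam j f))"
    by (simp_all only: opH_def opHi_def opK_opE opKi_opE opK_opF opKi_opF op_linear sc_simps d flip: power_int_add[OF disjI1, OF vq_nonzero])
       (simp_all add: cartan_def algebra_simps)
qed

section \<open>The highest weight module on words\<close>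

lemma serre_at_Nil [simp]: "serre (opF lam i) (opF lam j) f [] = 0"
  by (simp add: serre_def pw)

lemma opE_serre:
  assumes ij: "\<bar>i - j\<bar> = 1"
  shows "opE k (serre (opF lam i) (opF lam j) f) = serre (opF lam i) (opF lam j) (opE k f)"
proof -
  note lin = linop_opF[of lam i] linop_opF[of lam j] linop_opE[of k] linop_opH[of lam k] linop_opHi[of lam k]
  consider "k = i" "i \<noteq> j" | "k = j" "i \<noteq> j" | "k \<noteq> i" "k \<noteq> j" using ij by fastforce
  then show ?thesis
  proof cases
    case 1
    show ?thesis
      \<comment> \<open>By \<open>opH_opF\<close>, the operator \<open>opH lam i\<close> passes
        \<open>F_i\<close> with the factor \<open>v^(-2) = q * q\<close> and \<open>F_j\<close> with
        the factor \<open>v = p\<close>.\<close>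
      by (rule serre_commute_fst[OF lin, where q = "inverse vq" and p = vq and s = "inverse (vq - inverse vq)"])
        (use 1 in \<open>simp_all add: opE_opF opH_opF opHi_opF cartan_adjacent[OF ij] power2_eq_square power_int_minus\<close>)
  next
    case 2
    show ?thesis
      by (rule serre_commute_snd[OF lin, where q = vq and p = "inverse vq" and s = "inverse (vq - inverse vq)"])
        (use 2 in \<open>simp_all add: opE_opF opH_opF opHi_opF cartan_adjacent[OF ij] power2_eq_square power_int_minus\<close>)
  next
    case 3
    show ?thesis
      by (rule serre_commute[OF lin(1-3)]) (use 3 in \<open>simp_all add: opE_opF\<close>)
  qed
qed

lemma opF_serre:
  assumes ij: "\<bar>i - j\<bar> = 1"
  shows "opF lam k (serre (opE i) (opE j) f) = serre (opE i) (opE j) (opF lam k f)"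
proof -
  note lin = linop_opE[of i] linop_opE[of j] linop_opF[of lam k] linop_opH[of lam k] linop_opHi[of lam k]
  \<comment> \<open>The commutator of \<open>E\<close> and \<open>F\<close> solved for the other
    product, which changes the sign of the scalar \<open>s\<close>.\<close>
  have FE: "opF lam i (opE j f)
    = opE j (opF lam i f) + (if i = j then sc (- inverse (vq - inverse vq)) (opH lam i f - opHi lam i f) else 0)"
    for i j f by (simp add: opE_opF fun_eq_iff pw)
  consider "k = i" "i \<noteq> j" | "k = j" "i \<noteq> j" | "k \<noteq> i" "k \<noteq> j" using ij by fastforce
  then show ?thesis
  proof cases
    case 1
    show ?thesis
      by (rule serre_commute_fst[OF lin, where q = vq and p = "inverse vq" and s = "- inverse (vq - inverse vq)"])
        (use 1 in \<open>simp_all add: FE opH_opE opHi_opE cartan_adjacent[OF ij] power2_eq_square power_int_minus\<close>)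
  next
    case 2
    show ?thesis
      by (rule serre_commute_snd[OF lin, where q = "inverse vq" and p = vq and s = "- inverse (vq - inverse vq)"])
        (use 2 in \<open>simp_all add: FE opH_opE opHi_opE cartan_adjacent[OF ij] power2_eq_square power_int_minus\<close>)
  next
    case 3
    show ?thesis
      by (rule serre_commute[OF lin(1-3)]) (use 3 in \<open>simp_all add: FE\<close>)
  qed
qed

text \<open>The value at a word is reached by stripping its letters one at a time and evaluating at
  the empty word.\<close>

lemma eq_0_by_opE:
  assumes "\<And>f. P f \<Longrightarrow> f [] = 0" "\<And>f k. P f \<Longrightarrow> P (opE k f)" and "P f"
  shows "f = 0"
proof (rule ext)
  fix w
  have "P f \<Longrightarrow> f w = 0"
  proof (induction w arbitrary: f)
    case (Cons k w)
    then have "opE k f w = 0" using assms(2) by blast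
    then show ?case by (simp add: opE_def)
  qed (fact assms(1))
  then show "f w = 0 w" using assms(3) by (simp add: pw)
qed

text \<open>The range of the Serre operator is stable under all \<open>opE\<close> by
  \<open>opE_serre\<close>, and its members vanish at the empty word.\<close>

lemma serre_opF:
  assumes "\<bar>i - j\<bar> = 1"
  shows "serre (opF lam i) (opF lam j) f = 0"
  by (rule eq_0_by_opE[where P = "\<lambda>f. \<exists>g. f = serre (opF lam i) (opF lam j) g"])
    (auto simp: opE_serre[OF assms])

lemma opF_commute:
  assumes "\<bar>i - j\<bar> > 1"
  shows "opF lam i (opF lam j f) = opF lam j (opF lam i f)"
proof -
  let ?C = "\<lambda>f. opF lam i (opF lam j f) - opF lam j (opF lam i f)"
  have "opE k (?C f) = ?C (opE k f)" for k f
    using assms by (auto simp: op_linear opE_opF opH_opF opHi_opF cartan_far)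
  then have "?C f = 0"
    by (intro eq_0_by_opE[where P = "\<lambda>f. \<exists>g. f = ?C g"]) (auto simp: minus_apply)
  then show ?thesis by simp
qed

section \<open>The span generated by the highest weight vector\<close>

definition eps :: "int list \<Rightarrow> qv" where
  "eps = (\<lambda>w. if w = [] then 1 else 0)"

text \<open>Only the \<open>opF\<close> generate; stability under the other operators follows from
  the commutation rules. Passing to this span is essential: on arbitrary functions on words the
  \<open>opE\<close> need not satisfy the Serre relations.\<close>

inductive_set Om :: "weight \<Rightarrow> (int list \<Rightarrow> qv) set" for lam where
  eps: "eps \<in> Om lam"
| add: "f \<in> Om lam \<Longrightarrow> g \<in> Om lam \<Longrightarrow> f + g \<in> Om lam"
| sc: "f \<in> Om lam \<Longrightarrow> sc c f \<in> Om lam"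
| opF: "f \<in> Om lam \<Longrightarrow> opF lam i f \<in> Om lam"

lemma opE_eps [simp]: "opE i eps = 0"
  by (simp add: opE_def eps_def fun_eq_iff pw)

lemma opK_eps: "opK lam i eps = sc (vq powi lam i) eps"
  and opKi_eps: "opKi lam i eps = sc (vq powi (- lam i)) eps"
  by (simp_all add: fun_eq_iff eps_def opw)

lemma Om_zero: "0 \<in> Om lam"
  using Om.sc[OF Om.eps, of 0] by simp

lemma Om_diff: "f \<in> Om lam \<Longrightarrow> g \<in> Om lam \<Longrightarrow> f - g \<in> Om lam"
proof -
  assume "f \<in> Om lam" "g \<in> Om lam"
  then have "f + sc (- 1) g \<in> Om lam" by (intro Om.intros)
  then show ?thesis by (simp add: sc_neg)
qed

lemma Om_opK: "f \<in> Om lam \<Longrightarrow> opK lam i f \<in> Om lam"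
  by (induction rule: Om.induct) (auto simp: opK_eps opK_opF op_linear intro: Om.intros)

lemma Om_opKi: "f \<in> Om lam \<Longrightarrow> opKi lam i f \<in> Om lam"
  by (induction rule: Om.induct) (auto simp: opKi_eps opKi_opF op_linear intro: Om.intros)

lemma Om_opE: "f \<in> Om lam \<Longrightarrow> opE i f \<in> Om lam"
  by (induction rule: Om.induct)
    (auto simp: opE_opF op_linear Om_zero opH_def opHi_def intro!: Om.intros Om_diff Om_opK Om_opKi)

text \<open>The Serre element in the \<open>opE\<close> kills \<open>eps\<close> and commutes with
  every \<open>opF\<close>, hence kills all that the \<open>opF\<close> generate from
  \<open>eps\<close>.\<close>

lemma serre_opE:
  assumes "f \<in> Om lam" and ij: "\<bar>i - j\<bar> = 1"
  shows "serre (opE i) (opE j) f = 0"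
  using assms(1)
proof (induction rule: Om.induct)
  case (add f g)
  have "serre (opE i) (opE j) (f + g) = serre (opE i) (opE j) f + serre (opE i) (opE j) g"
    by (simp add: serre_def op_linear sc_distrib)
  then show ?case using add by simp
next
  case (sc f c)
  have "serre (opE i) (opE j) (sc c f) = sc c (serre (opE i) (opE j) f)"
    by (simp add: serre_def op_linear fun_eq_iff pw algebra_simps)
  then show ?case using sc by simp
next
  case (opF f k)
  then show ?case using opF_serre[OF ij, of lam k f] by (simp add: op_linear)
qed (simp add: serre_def op_linear)

lemma opE_commute:
  assumes "f \<in> Om lam" and ij: "\<bar>i - j\<bar> > 1"
  shows "opE i (opE j f) = opE j (opE i f)"
  using assms(1)
proof (induction rule: Om.induct)
  case (opF f k)
  show ?case
    using opF ij by (auto simp: op_linear opE_opF opH_opE opHi_opE cartan_far)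
qed (simp_all add: op_linear)

text \<open>Each \<open>opF\<close> lengthens the words of the support by at most one letter. The
  bound makes long \<open>E\<close>-words vanish and provides a longest word in the support.\<close>

lemma Om_bounded: "f \<in> Om lam \<Longrightarrow> \<exists>n. \<forall>w. length w \<ge> n \<longrightarrow> f w = 0"
proof (induction rule: Om.induct)
  case eps
  show ?case by (auto simp: eps_def intro!: exI[of _ 1])
next
  case (add f g)
  then obtain m n where "\<forall>w. length w \<ge> m \<longrightarrow> f w = 0" "\<forall>w. length w \<ge> n \<longrightarrow> g w = 0" by blast
  then show ?case by (auto simp: pw intro!: exI[of _ "max m n"])
next
  case (sc f c)
  then show ?case by (auto simp: pw)
next
  case (opF f i)
  have "\<forall>w. length w \<ge> Suc n \<longrightarrow> opF lam i f w = 0" if "\<forall>w. length w \<ge> n \<longrightarrow> f w = 0" for n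
  proof -
    have "length w \<ge> Suc n \<Longrightarrow> opF lam i f w = 0" for w
      using that
    proof (induction w arbitrary: f n)
      case (Cons k w)
      have "opF lam i (opE k f) w = 0"
      proof (cases n)
        \<comment> \<open>Here the bound says \<open>f = 0\<close>, and the induction hypothesis has
          no smaller bound to be used with.\<close>
        case 0
        then have "opE k f = 0" using Cons.prems(2) by (auto simp: opE_def fun_eq_iff pw)
        then show ?thesis by (simp add: op_linear pw)
      next
        case (Suc m)
        show ?thesis
          by (rule Cons.IH[where n = m]) (use Suc Cons.prems in \<open>auto simp: opE_def\<close>)
      qed
      then show ?case using Cons.prems by simp
    qed simp
    then show ?thesis by blast
  qed
  then show ?case using opF by blast
qed

section \<open>The free algebra acting on a module\<close>

lemma RELS_mem:
  "[(1, [Kinv i, K i]), (- 1, [])] \<in> RELS"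
  "[(1, [K i, E j]), (- (vq powi (dlt i j - dlt i (j + 1))), [E j, K i])] \<in> RELS"
  "[(1, [K i, F j]), (- (vq powi (dlt i (j + 1) - dlt i j)), [F j, K i])] \<in> RELS"
  "i \<noteq> j \<Longrightarrow> [(1, [E i, F j]), (- 1, [F j, E i])] \<in> RELS"
  by (simp_all add: RELS_def)

lemma RELS_EF:
  "[(1, [E i, F i]), (-1, [F i, E i]), (- inverse (vq - inverse vq), [K i, Kinv (i+1)]),
    (inverse (vq - inverse vq), [Kinv i, K (i+1)])] \<in> RELS"
  unfolding RELS_def by blast

lemma falg_ops: "fadd = (+)" "fsub = (-)" "fsmul = sc" "fzero = 0" "fone = fword []"
  by (auto simp: fun_eq_iff fadd_def fsub_def fsmul_def fzero_def fone_def fword_def pw)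

lemma linop_lgen: "linop (lgen g)" and linop_rgen: "linop (\<lambda>a. rgen a g)"
  by (auto intro!: linopI simp: lgen_def rgen_def pw split: list.split)

lemma lgen_fword [simp]: "lgen g (fword u) = fword (g # u)"
  by (auto simp: fun_eq_iff lgen_def fword_def split: list.split)

lemma rgen_fword [simp]: "rgen (fword u) g = fword (u @ [g])"
  by (auto simp: fun_eq_iff rgen_def fword_def append_butlast_last_id)

lemmas falg_linear = linop_simps[OF linop_lgen] linop_simps[OF linop_rgen]

lemma fa_of_simps [simp]: "fa_of [] = 0" "fa_of ((c, u) # r) = sc c (fword u) + fa_of r"
  by (auto simp: fun_eq_iff fa_of_def fword_def pw)

lemma FA_fword [simp, intro]: "fword u \<in> FA" and FA_0 [simp, intro]: "0 \<in> FA"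
  by (simp_all add: FA_def fword_def pw)

lemma FA_add [intro]: "a \<in> FA \<Longrightarrow> b \<in> FA \<Longrightarrow> a + b \<in> FA"
  unfolding FA_def mem_Collect_eq
  by (rule finite_subset[of _ "{w. a w \<noteq> 0} \<union> {w. b w \<noteq> 0}"]) (auto simp: pw)

lemma FA_diff [intro]: "a \<in> FA \<Longrightarrow> b \<in> FA \<Longrightarrow> a - b \<in> FA"
  unfolding FA_def mem_Collect_eq
  by (rule finite_subset[of _ "{w. a w \<noteq> 0} \<union> {w. b w \<noteq> 0}"]) (auto simp: pw)

lemma FA_sc [intro]: "a \<in> FA \<Longrightarrow> sc c a \<in> FA"
  unfolding FA_def mem_Collect_eq by (rule finite_subset[of _ "{w. a w \<noteq> 0}"]) (auto simp: pw)

lemma FA_lgen [intro]: "a \<in> FA \<Longrightarrow> lgen g a \<in> FA"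
  unfolding FA_def mem_Collect_eq
  by (rule finite_subset[of _ "(#) g ` {w. a w \<noteq> 0}"])
    (auto simp: lgen_def image_iff split: list.split_asm if_split_asm)

lemma FA_rgen [intro]: "a \<in> FA \<Longrightarrow> rgen a g \<in> FA"
  unfolding FA_def mem_Collect_eq
proof (rule finite_subset[of _ "(\<lambda>w. w @ [g]) ` {w. a w \<noteq> 0}"])
  show "{w. rgen a g w \<noteq> 0} \<subseteq> (\<lambda>w. w @ [g]) ` {w. a w \<noteq> 0}"
  proof
    fix w assume "w \<in> {w. rgen a g w \<noteq> 0}"
    then have "w \<noteq> []" "last w = g" "a (butlast w) \<noteq> 0" by (auto simp: rgen_def split: if_splits)
    then show "w \<in> (\<lambda>w. w @ [g]) ` {w. a w \<noteq> 0}"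
      by (auto intro!: image_eqI[of _ _ "butlast w"])
  qed
qed auto

lemma FA_fa_of [intro]: "fa_of r \<in> FA"
proof (induction r)
  case (Cons p r)
  obtain c u where "p = (c, u)" by force
  then show ?case using FA_add[OF FA_sc[OF FA_fword[of u], of c] Cons] by simp
qed simp

text \<open>The support is emptied word by word. The set \<open>U\<close> of admissible words keeps
  the induction inside a smaller span, such as that of the \<open>F\<close>-words.\<close>

lemma FA_induct_on [consumes 2, case_names zero add]:
  assumes "a \<in> FA" and "\<And>u. a u \<noteq> 0 \<Longrightarrow> u \<in> U"
    and "P 0" and "\<And>b c u. b \<in> FA \<Longrightarrow> u \<in> U \<Longrightarrow> P b \<Longrightarrow> P (b + sc c (fword u))"
  shows "P a"
proof -
  have "P a" if "finite A" "A \<subseteq> U" "\<And>u. a u \<noteq> 0 \<Longrightarrow> u \<in> A" for A a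
    using that
  proof (induction A arbitrary: a rule: finite_induct)
    case empty
    then have "a = 0" by (auto simp: fun_eq_iff pw)
    then show ?case using assms(3) by simp
  next
    case (insert u A)
    let ?b = "a - sc (a u) (fword u)"
    have supp: "w \<in> A" if "?b w \<noteq> 0" for w
      using that insert.prems(2)[of w] by (auto simp: pw fword_def split: if_splits)
    then have "finite {w. ?b w \<noteq> 0}"
      by (intro finite_subset[OF _ insert.hyps(1)]) auto
    then have "?b \<in> FA" by (simp add: FA_def)
    moreover have "P ?b" using insert.IH[of ?b] insert.prems(1) supp by blast
    ultimately have "P (?b + sc (a u) (fword u))" using insert.prems(1) assms(4) by blast
    then show ?case by simp
  qed
  from this[of "{w. a w \<noteq> 0}" a] show ?thesis using assms(1,2) by (auto simp: FA_def)
qed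

lemma FA_induct [consumes 1, case_names zero add]:
  assumes "a \<in> FA" "P 0" "\<And>b c u. b \<in> FA \<Longrightarrow> P b \<Longrightarrow> P (b + sc c (fword u))"
  shows "P a"
  by (rule FA_induct_on[of a UNIV]) (use assms in auto)

lemma lideal_least: "is_lideal J \<Longrightarrow> S \<subseteq> J \<Longrightarrow> lideal S \<subseteq> J"
proof
  fix a assume J: "is_lideal J" "S \<subseteq> J" and "a \<in> lideal S"
  from this(3) show "a \<in> J"
    by (induction rule: lideal.induct) (use J in \<open>auto simp: is_lideal_def\<close>)
qed

text \<open>The additive group in the multiplicative notation of HOL-Algebra, so that
  \<open>finprod\<close> serves as a finite sum inside the carrier.\<close>

definition addgrp :: "'m umod \<Rightarrow> 'm monoid" where
  "addgrp M = \<lparr>carrier = carr M, mult = madd M, one = mzero M\<rparr>"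

lemma addgrp_simps [simp]: "carrier (addgrp M) = carr M" "mult (addgrp M) = madd M"
  "one (addgrp M) = mzero M"
  by (simp_all add: addgrp_def)

text \<open>On \<open>FA\<close> this is the module map from the free algebra that sends 1 to
  \<open>x\<close>. For infinite support \<open>finprod\<close> defaults to
  \<open>mzero M\<close>.\<close>

definition ev :: "'m umod \<Rightarrow> 'm \<Rightarrow> falg \<Rightarrow> 'm" where
  "ev M x a = finprod (addgrp M) (\<lambda>w. msmul M (a w) (acts M w x)) {w. a w \<noteq> 0}"

lemma acts_simps [simp]: "acts M [] x = x" "acts M (g # u) x = mact M g (acts M u x)"
  by (simp_all add: acts_def)

lemma acts_append [simp]: "acts M (u @ w) x = acts M u (acts M w x)"
  by (simp add: acts_def)

section \<open>Calculus in an arbitrary module\<close>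

locale umodule =
  fixes M :: "'m umod"
  assumes umod: "is_umod M"
begin

lemma closed [simp, intro]:
  "mzero M \<in> carr M"
  "x \<in> carr M \<Longrightarrow> y \<in> carr M \<Longrightarrow> madd M x y \<in> carr M"
  "x \<in> carr M \<Longrightarrow> msmul M c x \<in> carr M"
  "x \<in> carr M \<Longrightarrow> mact M g x \<in> carr M"
  using umod by (simp_all add: is_umod_def)

lemma module_laws [simp]:
  "x \<in> carr M \<Longrightarrow> y \<in> carr M \<Longrightarrow> msmul M c (madd M x y) = madd M (msmul M c x) (msmul M c y)"
  "x \<in> carr M \<Longrightarrow> msmul M c (msmul M d x) = msmul M (c * d) x"
  "x \<in> carr M \<Longrightarrow> msmul M 1 x = x"
  "x \<in> carr M \<Longrightarrow> y \<in> carr M \<Longrightarrow> mact M g (madd M x y) = madd M (mact M g x) (mact M g y)"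
  "x \<in> carr M \<Longrightarrow> mact M g (msmul M c x) = msmul M c (mact M g x)"
  using umod by (simp_all add: is_umod_def)

lemma smul_add_left: "x \<in> carr M \<Longrightarrow> msmul M (c + d) x = madd M (msmul M c x) (msmul M d x)"
  using umod unfolding is_umod_def by metis

lemma opr_RELS: "r \<in> RELS \<Longrightarrow> x \<in> carr M \<Longrightarrow> opr M r x = mzero M"
  using umod unfolding is_umod_def by blast

lemma add_assoc: "x \<in> carr M \<Longrightarrow> y \<in> carr M \<Longrightarrow> z \<in> carr M \<Longrightarrow> madd M (madd M x y) z = madd M x (madd M y z)"
  using umod unfolding is_umod_def by metis

lemma add_commute: "x \<in> carr M \<Longrightarrow> y \<in> carr M \<Longrightarrow> madd M x y = madd M y x"
  using umod unfolding is_umod_def by metis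

lemma add_zero_left: "x \<in> carr M \<Longrightarrow> madd M (mzero M) x = x"
  using umod unfolding is_umod_def by metis

lemma neg_exists: "x \<in> carr M \<Longrightarrow> \<exists>y\<in>carr M. madd M x y = mzero M"
  using umod unfolding is_umod_def by metis

sublocale G: comm_group "addgrp M"
proof (rule comm_groupI)
  fix x assume "x \<in> carrier (addgrp M)"
  then show "\<exists>y\<in>carrier (addgrp M). y \<otimes>\<^bsub>addgrp M\<^esub> x = \<one>\<^bsub>addgrp M\<^esub>"
    using neg_exists add_commute by auto metis
qed (simp_all add: add_assoc add_zero_left, simp add: add_commute)

lemmas add_zero [simp] = G.l_one[simplified] G.r_one[simplified]

lemma smul_zero_left [simp]: assumes "x \<in> carr M" shows "msmul M 0 x = mzero M"
proof -
  have "madd M (msmul M 0 x) (msmul M 0 x) = msmul M 0 x"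
    using smul_add_left[of x 0 0] assms by simp
  then show ?thesis using G.l_cancel_one[of "msmul M 0 x" "msmul M 0 x"] assms by simp
qed

lemma smul_zero_right [simp]: "msmul M c (mzero M) = mzero M"
  using module_laws(2)[of "mzero M" c 0] by simp

lemma act_zero [simp]: "mact M g (mzero M) = mzero M"
  using module_laws(5)[of "mzero M" g 0] by simp

lemma add_neg_eq_zero_iff:
  assumes "x \<in> carr M" "y \<in> carr M"
  shows "madd M x (msmul M (- c) y) = mzero M \<longleftrightarrow> x = msmul M c y"
proof -
  have *: "madd M (msmul M c y) (msmul M (- c) y) = mzero M"
    using smul_add_left[of y c "- c"] assms by simp
  then show ?thesis
    using G.right_cancel[of "msmul M (- c) y" x "msmul M c y"] assms by auto
qed

lemma smul_eq_zero_iff [simp]: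
  assumes "x \<in> carr M" shows "msmul M c x = mzero M \<longleftrightarrow> c = 0 \<or> x = mzero M"
proof -
  have "x = msmul M (inverse c) (msmul M c x)" if "c \<noteq> 0" using assms that by simp
  then show ?thesis using assms by (metis smul_zero_left smul_zero_right)
qed

lemma acts_closed [simp, intro]: "x \<in> carr M \<Longrightarrow> acts M u x \<in> carr M"
  by (induction u) auto

lemma acts_add [simp]:
    "x \<in> carr M \<Longrightarrow> y \<in> carr M \<Longrightarrow> acts M u (madd M x y) = madd M (acts M u x) (acts M u y)"
  and acts_smul [simp]: "x \<in> carr M \<Longrightarrow> acts M u (msmul M c x) = msmul M c (acts M u x)"
  and acts_zero [simp]: "acts M u (mzero M) = mzero M"
  by (induction u) auto

lemma ev_superset:
  assumes "finite B" "{w. a w \<noteq> 0} \<subseteq> B" "x \<in> carr M"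
  shows "ev M x a = finprod (addgrp M) (\<lambda>w. msmul M (a w) (acts M w x)) B"
  unfolding ev_def using assms
  by (intro G.finprod_mono_neutral_cong_left) auto

lemma ev_closed [simp, intro]: "x \<in> carr M \<Longrightarrow> ev M x a \<in> carr M"
  unfolding ev_def using G.finprod_closed[of _ "{w. a w \<noteq> 0}"] by auto

lemma ev_add [simp]:
  assumes "a \<in> FA" "b \<in> FA" "x \<in> carr M"
  shows "ev M x (a + b) = madd M (ev M x a) (ev M x b)"
proof -
  let ?B = "{w. a w \<noteq> 0} \<union> {w. b w \<noteq> 0}"
  have B: "finite ?B" using assms by (simp add: FA_def)
  have *: "ev M x c = finprod (addgrp M) (\<lambda>w. msmul M (c w) (acts M w x)) ?B"
    if "{w. c w \<noteq> 0} \<subseteq> ?B" for c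
    by (rule ev_superset[OF B that assms(3)])
  have "finprod (addgrp M) (\<lambda>w. msmul M ((a + b) w) (acts M w x)) ?B
      = finprod (addgrp M) (\<lambda>w. madd M (msmul M (a w) (acts M w x)) (msmul M (b w) (acts M w x))) ?B"
    using assms(3) by (simp add: pw smul_add_left)
  also have "\<dots> = madd M (ev M x a) (ev M x b)"
    using assms(3) G.finprod_multf[of "\<lambda>w. msmul M (a w) (acts M w x)" ?B
        "\<lambda>w. msmul M (b w) (acts M w x)"] by (subst (1 2) *) auto
  finally show ?thesis by (subst *) (auto simp: pw)
qed

lemma ev_sc_fword [simp]: "x \<in> carr M \<Longrightarrow> ev M x (sc c (fword u)) = msmul M c (acts M u x)"
proof -
  assume x: "x \<in> carr M"
  have "{w. sc c (fword u) w \<noteq> 0} \<subseteq> {u}" by (auto simp: fword_def pw split: if_splits)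
  from ev_superset[OF _ this x] have "ev M x (sc c (fword u))
      = madd M (msmul M (sc c (fword u) u) (acts M u x)) (mzero M)" using x by simp
  then show ?thesis using x by (simp add: fword_def pw)
qed

lemma ev_fword [simp]: "x \<in> carr M \<Longrightarrow> ev M x (fword u) = acts M u x"
  using ev_sc_fword[of x 1 u] by simp

lemma ev_0 [simp]: "ev M x 0 = mzero M"
  by (simp add: ev_def pw)

lemma ev_sc [simp]: "a \<in> FA \<Longrightarrow> x \<in> carr M \<Longrightarrow> ev M x (sc c a) = msmul M c (ev M x a)"
  by (induction a rule: FA_induct) (simp_all add: sc_distrib FA_sc)

lemma ev_lgen [simp]: "a \<in> FA \<Longrightarrow> x \<in> carr M \<Longrightarrow> ev M x (lgen g a) = mact M g (ev M x a)"
  by (induction a rule: FA_induct) (simp_all add: falg_linear FA_sc FA_lgen)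

lemma ev_rgen: "a \<in> FA \<Longrightarrow> x \<in> carr M \<Longrightarrow> ev M x (rgen a g) = ev M (mact M g x) a"
  by (induction a rule: FA_induct) (simp_all add: falg_linear FA_sc FA_rgen)

lemma ev_fa_of: "x \<in> carr M \<Longrightarrow> ev M x (fa_of r) = opr M r x"
  by (induction r) (auto simp: opr_def msum_def FA_sc FA_fa_of)

lemma ev_diff_eq_zero_iff [simp]:
  assumes "a \<in> FA" "b \<in> FA" "x \<in> carr M"
  shows "ev M x (a - b) = mzero M \<longleftrightarrow> ev M x a = ev M x b"
proof -
  show ?thesis unfolding sc_neg(2)[symmetric] using assms add_neg_eq_zero_iff[of "ev M x a" "ev M x b" 1]
    by (simp add: FA_sc)
qed

definition ann :: "'m \<Rightarrow> falg set" where
  "ann x = {a \<in> FA. ev M x a = mzero M}"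

lemma is_lideal_ann: "x \<in> carr M \<Longrightarrow> is_lideal (ann x)"
  by (auto simp: is_lideal_def ann_def falg_ops)

text \<open>The induction has to speak of all vectors at once: by \<open>ev_rgen\<close>, right
  multiplication by \<open>g\<close> replaces \<open>x\<close> by \<open>g x\<close>.\<close>

lemma RI_ann: "a \<in> RI \<Longrightarrow> a \<in> FA \<and> (\<forall>x\<in>carr M. ev M x a = mzero M)"
  unfolding RI_def
  by (induction rule: tideal.induct) (auto simp: falg_ops ev_rgen ev_fa_of opr_RELS)

lemma Verma_ideal_ann:
  assumes "x \<in> wspace M lam" and "\<And>i. mact M (E i) x = mzero M"
  shows "Verma_ideal lam \<subseteq> ann x"
proof -
  have x: "x \<in> carr M" using assms by (simp add: wspace_def)
  show ?thesis
    unfolding Verma_ideal_def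
    by (rule lideal_least[OF is_lideal_ann[OF x]])
      (use assms x RI_ann in \<open>auto simp: ann_def falg_ops FA_sc wspace_def\<close>)
qed

end

section \<open>The model is an irreducible module\<close>

definition act :: "weight \<Rightarrow> gen \<Rightarrow> (int list \<Rightarrow> qv) \<Rightarrow> int list \<Rightarrow> qv" where
  "act lam g = (case g of E i \<Rightarrow> opE i | F i \<Rightarrow> opF lam i | K i \<Rightarrow> opK lam i | Kinv i \<Rightarrow> opKi lam i)"

lemma act_simps [simp]: "act lam (E i) = opE i" "act lam (F i) = opF lam i"
  "act lam (K i) = opK lam i" "act lam (Kinv i) = opKi lam i"
  by (simp_all add: act_def)

lemma linop_act: "linop (act lam g)"
  by (cases g) (simp_all add: linop_opE linop_opF linop_opK linop_opKi)

lemma Om_act: "f \<in> Om lam \<Longrightarrow> act lam g f \<in> Om lam"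
  by (cases g) (simp_all add: Om_opE Om.opF Om_opK Om_opKi)

definition wordmod :: "weight \<Rightarrow> (int list \<Rightarrow> qv) umod" where
  "wordmod lam = \<lparr>carr = Om lam, mzero = 0, madd = (+), msmul = sc, mact = act lam\<rparr>"

lemma wordmod_simps [simp]: "carr (wordmod lam) = Om lam" "mzero (wordmod lam) = 0" "madd (wordmod lam) = (+)"
  "msmul (wordmod lam) = sc" "mact (wordmod lam) = act lam"
  by (simp_all add: wordmod_def)

lemma opK_opKi [simp]: "opK lam i (opKi lam i f) = f" "opKi lam i (opK lam i f) = f"
  by (simp_all add: fun_eq_iff opw flip: power_int_add mult.assoc)

lemma opr_wordmod:
  assumes r: "r \<in> RELS" and f: "f \<in> Om lam"
  shows "opr (wordmod lam) r f = 0"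
proof -
  note s = opr_def msum_def acts_def
  have EF: "opr (wordmod lam) [(1, [E i, F i]), (-1, [F i, E i]),
        (- inverse (vq - inverse vq), [K i, Kinv (i+1)]),
        (inverse (vq - inverse vq), [Kinv i, K (i+1)])] f = 0" for i
    by (simp add: s opE_opF opH_def opHi_def fun_eq_iff pw algebra_simps)
  have SE: "opr (wordmod lam) [(1, [E i, E i, E j]), (- (vq + inverse vq), [E i, E j, E i]), (1, [E j, E i, E i])] f = 0"
    if "\<bar>i - j\<bar> = 1" for i j
    using serre_opE[OF f that] by (simp add: s serre_def fun_eq_iff pw algebra_simps)
  have SF: "opr (wordmod lam) [(1, [F i, F i, F j]), (- (vq + inverse vq), [F i, F j, F i]), (1, [F j, F i, F i])] f = 0"
    if "\<bar>i - j\<bar> = 1" for i j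
    using serre_opF[OF that, of lam f] by (simp add: s serre_def fun_eq_iff pw algebra_simps)
  have KK: "opK lam i (opK lam j f) = opK lam j (opK lam i f)" for i j
    by (simp add: fun_eq_iff opw algebra_simps)
  show ?thesis
    using r EF SE SF unfolding RELS_def Un_iff mem_Collect_eq
    by (elim disjE exE conjE)
      (simp_all add: s sc_neg KK opK_opE opK_opF opE_opF opE_commute[OF f] opF_commute)
qed

lemma is_umod_wordmod: "is_umod (wordmod lam)"
proof -
  have "\<exists>g\<in>Om lam. f + g = 0" if "f \<in> Om lam" for f
    using Om_diff[OF Om_zero that] by (intro bexI[of _ "0 - f"]) auto
  then show ?thesis
    unfolding is_umod_def
    by (auto simp: Om_zero Om.intros Om_act algebra_simps sc_distrib linop_simps[OF linop_act] opr_wordmod)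
qed

interpretation wordmod: umodule "wordmod lam" for lam
  by unfold_locales (rule is_umod_wordmod)

text \<open>The \<open>K_i\<close> act diagonally, and distinct weights have distinct systems of
  eigenvalues by \<open>vq_powi_eq_iff\<close>.\<close>

lemma wspace_wordmod: "wspace (wordmod lam) mu = {f \<in> Om lam. \<forall>w. f w \<noteq> 0 \<longrightarrow> wtw lam w = mu}"
proof -
  have "(\<forall>i. opK lam i f = sc (vq powi mu i) f) \<longleftrightarrow> (\<forall>w. f w \<noteq> 0 \<longrightarrow> wtw lam w = mu)" for f
    by (auto simp: fun_eq_iff opw)
  then show ?thesis by (simp add: wspace_def)
qed

lemma eps_wspace: "eps \<in> wspace (wordmod lam) lam"
  using Om.eps[of lam] by (auto simp: wspace_wordmod eps_def split: if_splits)

lemma eps_nonzero [simp]: "eps \<noteq> 0"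
  by (auto simp: fun_eq_iff eps_def pw)

text \<open>The rightmost letter of \<open>u\<close> acts first and so becomes the first letter of
  the word, which explains the reversal.\<close>

lemma acts_E_wordmod: "acts (wordmod lam) (map E u) f w = f (rev u @ w)"
  by (induction u arbitrary: w) (simp_all add: opE_def)

lemma E_word: "set u \<subseteq> range E \<Longrightarrow> \<exists>v. u = map E v"
  by (metis ex_map_conv subset_iff image_iff)

lemma E_words_vanish_wordmod:
  assumes "f \<in> Om lam"
  shows "\<exists>n0. \<forall>u. set u \<subseteq> range E \<and> length u \<ge> n0 \<longrightarrow> acts (wordmod lam) u f = 0"
proof -
  obtain n where n: "\<And>w. length w \<ge> n \<Longrightarrow> f w = 0" using Om_bounded[OF assms] by blast
  have "acts (wordmod lam) u f = 0" if u: "set u \<subseteq> range E" "length u \<ge> n" for u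
  proof -
    obtain v where v: "u = map E v" using E_word[OF u(1)] by blast
    then show ?thesis using u(2) by (auto simp: fun_eq_iff acts_E_wordmod pw intro!: n)
  qed
  then show ?thesis by blast
qed

text \<open>Stripping a longest word of the support leaves a function supported on the empty word
  alone.\<close>

lemma acts_E_eq_eps:
  assumes "f \<in> Om lam" "f \<noteq> 0"
  obtains u c where "c \<noteq> 0" "acts (wordmod lam) (map E u) f = sc c eps"
proof -
  let ?P = "\<lambda>n. \<exists>w. f w \<noteq> 0 \<and> length w = n"
  obtain b where b: "\<And>w. length w \<ge> b \<Longrightarrow> f w = 0" using Om_bounded[OF assms(1)] by blast
  have 1: "\<exists>n. ?P n" using assms(2) by (auto simp: fun_eq_iff pw)
  have 2: "\<And>n. ?P n \<Longrightarrow> n \<le> b" using b by (meson nat_le_linear)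
  from GreatestI_ex_nat[of ?P, OF 1 2] Greatest_le_nat[of ?P, OF _ 2]
  obtain w where w: "f w \<noteq> 0" "\<And>w'. f w' \<noteq> 0 \<Longrightarrow> length w' \<le> length w" by metis
  have "f (w @ v) = 0" if "v \<noteq> []" for v
    using w(2)[of "w @ v"] that by auto
  then have "acts (wordmod lam) (map E (rev w)) f = sc (f w) eps"
    by (auto simp: fun_eq_iff acts_E_wordmod eps_def pw)
  with w(1) that show thesis by blast
qed

text \<open>By \<open>acts_E_eq_eps\<close> a nonzero submodule contains \<open>eps\<close>, from
  which the \<open>opF\<close> generate everything.\<close>

lemma irreducible_wordmod: "umod_irreducible (wordmod lam)"
  unfolding umod_irreducible_def
proof (intro conjI allI impI)
  show "carr (wordmod lam) \<noteq> {mzero (wordmod lam)}"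
    using Om.eps[of lam] by auto
next
  fix S
  assume S: "is_submod (wordmod lam) S"
  have Sadd: "f + g \<in> S" if "f \<in> S" "g \<in> S" for f g using S that by (simp add: is_submod_def)
  have Ssc: "sc c f \<in> S" if "f \<in> S" for c f using S that by (simp add: is_submod_def)
  have Sact: "act lam g f \<in> S" if "f \<in> S" for g f using S that by (simp add: is_submod_def)
  have sub: "S \<subseteq> Om lam" using S by (simp add: is_submod_def)
  have "S = Om lam" if f: "f \<in> S" "f \<noteq> 0" for f
  proof -
    obtain u c where c: "c \<noteq> 0" "acts (wordmod lam) (map E u) f = sc c eps"
      using acts_E_eq_eps f sub by blast
    have "acts (wordmod lam) v f \<in> S" for v
      by (induction v) (use f Sact in simp_all)
    then have "sc (inverse c) (sc c eps) \<in> S" using Ssc c(2) by metis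
    then have "eps \<in> S" using c(1) by simp
    have "g \<in> S" if "g \<in> Om lam" for g
      using that
    proof (induction rule: Om.induct)
      case (opF g i)
      then show ?case using Sact[of g "F i"] by simp
    qed (use \<open>eps \<in> S\<close> Sadd Ssc in auto)
    with sub show ?thesis by auto
  qed
  moreover have "0 \<in> S" using S by (simp add: is_submod_def)
  ultimately show "S = {mzero (wordmod lam)} \<or> S = carr (wordmod lam)" by auto
qed

section \<open>The maximal left ideal\<close>

lemma wtw_count: "wtw lam w j = lam j - int (count_list w j) + int (count_list w (j - 1))"
  by (induction w) (auto simp: dlt_def)

text \<open>At the smallest letter \<open>i\<close> of \<open>w\<close> the coordinate drops by the
  number of its occurrences, and no letter \<open>i - 1\<close> is present to raise it
  again.\<close>

lemma wtw_neq_Nil: assumes "w \<noteq> []" shows "\<exists>i. wtw lam w i \<noteq> lam i"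
proof -
  let ?i = "Min (set w)"
  have "?i \<in> set w" using assms by simp
  moreover have "?i - 1 \<notin> set w"
  proof
    assume "?i - 1 \<in> set w"
    then have "?i \<le> ?i - 1" by (intro Min_le) auto
    then show False by simp
  qed
  ultimately have "wtw lam w ?i \<noteq> lam ?i"
    by (simp add: wtw_count count_list_0_iff)
  then show ?thesis by blast
qed

lemma is_lideal_lideal: assumes "S \<subseteq> FA" shows "is_lideal (lideal S)"
proof -
  have "a \<in> FA" if "a \<in> lideal S" for a
    using that by (induction rule: lideal.induct) (use assms in \<open>auto simp: falg_ops FA_sc FA_add FA_lgen\<close>)
  then show ?thesis by (auto simp: is_lideal_def intro: lideal.intros)
qed

lemma lideal_closed:
  assumes "is_lideal J"
  shows "a \<in> J \<Longrightarrow> a \<in> FA" "0 \<in> J" "a \<in> J \<Longrightarrow> b \<in> J \<Longrightarrow> a + b \<in> J"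
    "a \<in> J \<Longrightarrow> sc c a \<in> J" "a \<in> J \<Longrightarrow> lgen g a \<in> J"
  using assms by (auto simp: is_lideal_def falg_ops)

lemma lideal_diff: assumes "is_lideal J" "a \<in> J" "b \<in> J" shows "a - b \<in> J"
proof -
  show ?thesis unfolding sc_neg(2)[symmetric] by (intro lideal_closed(3,4)[OF assms(1)] assms)
qed

lemma RI_FA: "a \<in> RI \<Longrightarrow> a \<in> FA"
  using wordmod.RI_ann by blast

lemma is_lideal_Verma: "is_lideal (Verma_ideal lam)"
  unfolding Verma_ideal_def
  by (rule is_lideal_lideal) (auto simp: falg_ops RI_FA FA_diff FA_sc)

lemmas Verma_closed = lideal_closed[OF is_lideal_Verma] lideal_diff[OF is_lideal_Verma]

lemma Verma_ideal_base:
  "a \<in> RI \<Longrightarrow> a \<in> Verma_ideal lam" "fword [E i] \<in> Verma_ideal lam"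
  "fword [K i] - sc (vq powi lam i) (fword []) \<in> Verma_ideal lam"
  by (auto simp: Verma_ideal_def falg_ops intro!: lideal.base)

section \<open>Reduction to \<open>F\<close>-words modulo the Verma ideal\<close>

definition rword :: "gen list \<Rightarrow> falg \<Rightarrow> falg" where
  "rword w a = foldl rgen a w"

lemma rword_fword [simp]: "rword w (fword u) = fword (u @ w)"
  unfolding rword_def by (induction w arbitrary: u) simp_all

lemma linop_rword: "linop (rword w)"
proof -
  have "rword w (a + b) = rword w a + rword w b" "rword w (sc c a) = sc c (rword w a)" for a b c
    unfolding rword_def by (induction w arbitrary: a b) (simp_all add: falg_linear)
  then show ?thesis by (simp add: linop_def)
qed

text \<open>The Verma ideal is only a left ideal, so the multiplication from the right is carried
  out in the two-sided ideal \<open>RI\<close>.\<close>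

lemma RELS_rword: "r \<in> RELS \<Longrightarrow> rword w (fa_of r) \<in> Verma_ideal lam"
proof -
  assume r: "r \<in> RELS"
  have "foldl rgen a w \<in> RI" if "a \<in> RI" for a
    using that unfolding RI_def by (induction w arbitrary: a) (auto intro: tideal.rmul)
  moreover have "fa_of r \<in> RI" using r unfolding RI_def by (auto intro: tideal.base)
  ultimately show ?thesis unfolding rword_def by (auto intro: Verma_ideal_base)
qed

lemma Verma_KF: "fword (K i # F j # w) - sc (vq powi (dlt i (j + 1) - dlt i j)) (fword (F j # K i # w)) \<in> Verma_ideal lam"
    and Verma_KK: "fword (Kinv i # K i # w) - fword w \<in> Verma_ideal lam"
    and Verma_EF: "i \<noteq> j \<Longrightarrow> fword (E i # F j # w) - fword (F j # E i # w) \<in> Verma_ideal lam"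
    and Verma_EF': "fword (E i # F i # w) - fword (F i # E i # w)
       + (sc (- inverse (vq - inverse vq)) (fword (K i # Kinv (i + 1) # w))
       + sc (inverse (vq - inverse vq)) (fword (Kinv i # K (i + 1) # w))) \<in> Verma_ideal lam"
proof -
  note l = linop_simps[OF linop_rword]
  have m: "r \<in> RELS \<Longrightarrow> rword w (fa_of r) \<in> Verma_ideal lam" for r by (rule RELS_rword)
  show "fword (K i # F j # w) - sc (vq powi (dlt i (j + 1) - dlt i j)) (fword (F j # K i # w)) \<in> Verma_ideal lam"
    using m[of "[(1, [K i, F j]), (- (vq powi (dlt i (j+1) - dlt i j)), [F j, K i])]"]
    by (simp add: l sc_neg RELS_mem)
  show "fword (Kinv i # K i # w) - fword w \<in> Verma_ideal lam"
    using m[of "[(1, [Kinv i, K i]), (-1, [])]"]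
    by (simp add: l sc_neg RELS_mem)
  show "fword (E i # F j # w) - fword (F j # E i # w) \<in> Verma_ideal lam" if "i \<noteq> j"
    using m[of "[(1, [E i, F j]), (-1, [F j, E i])]"] that
    by (simp add: l sc_neg RELS_mem)
  show "fword (E i # F i # w) - fword (F i # E i # w)
       + (sc (- inverse (vq - inverse vq)) (fword (K i # Kinv (i + 1) # w))
       + sc (inverse (vq - inverse vq)) (fword (Kinv i # K (i + 1) # w))) \<in> Verma_ideal lam"
  proof -
    let ?r = "[(1, [E i, F i]), (-1, [F i, E i]),
        (- inverse (vq - inverse vq), [K i, Kinv (i+1)]),
        (inverse (vq - inverse vq), [Kinv i, K (i+1)])]"
    have "rword w (fa_of ?r) = fword (E i # F i # w) - fword (F i # E i # w)
       + (sc (- inverse (vq - inverse vq)) (fword (K i # Kinv (i + 1) # w))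
       + sc (inverse (vq - inverse vq)) (fword (Kinv i # K (i + 1) # w)))"
      by (simp add: l) (simp add: fun_eq_iff pw)
    then show ?thesis using m[OF RELS_EF] by metis
  qed
qed

text \<open>\<open>K_i\<close> is moved past the letters, collecting the weight of the word, until
  it meets its own generator of the Verma ideal.\<close>

lemma Verma_K: "fword (K i # map F w) - sc (vq powi wtw lam w i) (fword (map F w)) \<in> Verma_ideal lam"
proof (induction w)
  case Nil
  show ?case unfolding list.map wtw.simps by (rule Verma_ideal_base(3))
next
  case (Cons j w)
  let ?c = "vq powi (dlt i (j + 1) - dlt i j)" and ?w = "fword (map F w)"
  have "sc ?c (lgen (F j) (fword (K i # map F w) - sc (vq powi wtw lam w i) ?w)) \<in> Verma_ideal lam"
    by (intro Verma_closed(4,5) Cons)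
  with Verma_KF[of i j "map F w" lam]
  have "(fword (K i # F j # map F w) - sc ?c (fword (F j # K i # map F w)))
      + sc ?c (lgen (F j) (fword (K i # map F w) - sc (vq powi wtw lam w i) ?w)) \<in> Verma_ideal lam"
    by (rule Verma_closed)
  moreover have "?c * vq powi wtw lam w i = vq powi wtw lam (j # w) i"
    by (simp add: algebra_simps flip: power_int_add)
  ultimately show ?case by (simp add: falg_linear sc_distrib)
qed

text \<open>Multiply \<open>Verma_K\<close> by \<open>Kinv i\<close> from the left, cancel
  \<open>Kinv i\<close> against \<open>K i\<close>, and divide by the eigenvalue.\<close>

lemma Verma_Kinv: "fword (Kinv i # map F w) - sc (vq powi (- wtw lam w i)) (fword (map F w)) \<in> Verma_ideal lam"
proof -
  let ?c = "vq powi wtw lam w i" and ?w = "fword (map F w)"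
  have "lgen (Kinv i) (fword (K i # map F w) - sc ?c ?w) \<in> Verma_ideal lam"
    by (intro Verma_closed(5) Verma_K)
  from Verma_closed(4)[OF Verma_closed(6)[OF Verma_KK[of i "map F w"] this]]
  have "sc (inverse ?c) ((fword (Kinv i # K i # map F w) - ?w)
      - lgen (Kinv i) (fword (K i # map F w) - sc ?c ?w)) \<in> Verma_ideal lam" .
  then show ?thesis
    by (simp add: falg_linear sc_distrib power_int_minus)
qed

definition Fspan :: "falg set" where
  "Fspan = {b \<in> FA. \<forall>u. b u \<noteq> 0 \<longrightarrow> u \<in> range (map F)}"

lemma Fspan_FA: "b \<in> Fspan \<Longrightarrow> b \<in> FA"
  by (simp add: Fspan_def)

lemma Fspan_induct [consumes 1, case_names zero add]:
  assumes "b \<in> Fspan" "P 0"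
    "\<And>b c w. b \<in> FA \<Longrightarrow> P b \<Longrightarrow> P (b + sc c (fword (map F w)))"
  shows "P b"
  by (rule FA_induct_on[of b "range (map F)"]) (use assms in \<open>auto simp: Fspan_def\<close>)

lemma Fspan_closed: "a \<in> Fspan \<Longrightarrow> b \<in> Fspan \<Longrightarrow> a + b \<in> Fspan" "a \<in> Fspan \<Longrightarrow> sc c a \<in> Fspan"
  "0 \<in> Fspan" "fword (map F w) \<in> Fspan"
     apply (auto simp: Fspan_def FA_add FA_sc pw)
   apply (metis add.right_neutral)
  apply (simp add: fword_def split: if_splits)
  done

text \<open>Elements congruent to a combination of \<open>F\<close>-words. Closure under left
  multiplication by the generators will show that this is everything, the spanning half of the
  triangular decomposition of a Verma module.\<close>

definition Verma_spanned :: "weight \<Rightarrow> falg set" where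
  "Verma_spanned lam = {a. \<exists>b\<in>Fspan. a - b \<in> Verma_ideal lam}"

lemma Verma_spanned_Fspan: "b \<in> Fspan \<Longrightarrow> b \<in> Verma_spanned lam"
  unfolding Verma_spanned_def using Verma_closed(2)[of lam] by force

lemma Verma_spanned_add: "a \<in> Verma_spanned lam \<Longrightarrow> b \<in> Verma_spanned lam \<Longrightarrow> a + b \<in> Verma_spanned lam"
  unfolding Verma_spanned_def mem_Collect_eq
proof (elim bexE)
  fix a' b' assume "a' \<in> Fspan" "b' \<in> Fspan" "a - a' \<in> Verma_ideal lam" "b - b' \<in> Verma_ideal lam"
  then show "\<exists>c\<in>Fspan. a + b - c \<in> Verma_ideal lam"
    using Verma_closed(3)[of "a - a'" lam "b - b'"]
    by (intro bexI[of _ "a' + b'"] Fspan_closed) (simp_all add: algebra_simps)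
qed

lemma Verma_spanned_sc: "a \<in> Verma_spanned lam \<Longrightarrow> sc c a \<in> Verma_spanned lam"
  unfolding Verma_spanned_def mem_Collect_eq
proof (elim bexE)
  fix a' assume "a' \<in> Fspan" "a - a' \<in> Verma_ideal lam"
  then show "\<exists>b\<in>Fspan. sc c a - b \<in> Verma_ideal lam"
    using Verma_closed(4)[of "a - a'" lam c]
    by (intro bexI[of _ "sc c a'"] Fspan_closed) (simp_all add: sc_distrib)
qed

lemma Verma_spanned_Verma: "a \<in> Verma_ideal lam \<Longrightarrow> a \<in> Verma_spanned lam"
  unfolding Verma_spanned_def using Fspan_closed(3) by force

lemma Verma_spanned_cong: "a - b \<in> Verma_ideal lam \<Longrightarrow> b \<in> Verma_spanned lam \<Longrightarrow> a \<in> Verma_spanned lam"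
  using Verma_spanned_add[of "a - b" lam b] Verma_spanned_Verma by simp

lemma Verma_spanned_lgen_if:
  assumes "\<And>w. fword (g # map F w) \<in> Verma_spanned lam" and "a \<in> Verma_spanned lam"
  shows "lgen g a \<in> Verma_spanned lam"
proof -
  obtain b where b: "b \<in> Fspan" "a - b \<in> Verma_ideal lam" using assms(2) by (auto simp: Verma_spanned_def)
  have "lgen g b \<in> Verma_spanned lam"
    using b(1)
    by (induction b rule: Fspan_induct)
      (simp_all add: falg_linear Verma_spanned_add Verma_spanned_sc assms(1) Verma_spanned_Fspan Fspan_closed(3))
  moreover have "lgen g a - lgen g b \<in> Verma_ideal lam"
    using Verma_closed(5)[OF b(2), of g] by (simp add: falg_linear)
  ultimately show ?thesis by (rule Verma_spanned_cong[rotated])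
qed

lemma Verma_spanned_lgen:
  assumes "a \<in> Verma_spanned lam" shows "lgen g a \<in> Verma_spanned lam"
proof -
  have F: "fword (F i # map F w) \<in> Verma_spanned lam" for i w
    using Verma_spanned_Fspan[OF Fspan_closed(4)[of "i # w"]] by simp
  have K: "fword (K i # map F w) \<in> Verma_spanned lam" for i w
    using Verma_spanned_cong[OF Verma_K Verma_spanned_sc[OF Verma_spanned_Fspan[OF Fspan_closed(4)]]] .
  have Ki: "fword (Kinv i # map F w) \<in> Verma_spanned lam" for i w
    using Verma_spanned_cong[OF Verma_Kinv Verma_spanned_sc[OF Verma_spanned_Fspan[OF Fspan_closed(4)]]] .
  \<comment> \<open>\<open>E_i\<close> is moved past the first \<open>F\<close>. If the indices
    agree, the commutator adds two words that begin with Cartan generators, which are covered by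
    \<open>K\<close> and \<open>Ki\<close>.\<close>
  have E: "fword (E i # map F w) \<in> Verma_spanned lam" for i w
  proof (induction w)
    case Nil
    then show ?case using Verma_spanned_Verma[OF Verma_ideal_base(2)] by simp
  next
    case (Cons j w)
    have FE: "fword (F j # E i # map F w) \<in> Verma_spanned lam"
      using Verma_spanned_lgen_if[OF F Cons, of j] by simp
    show ?case
    proof (cases "i = j")
      case False
      show ?thesis using Verma_spanned_cong[OF Verma_EF[OF False] FE] by simp
    next
      case True
      let ?s = "inverse (vq - inverse vq)"
      let ?A = "fword (K i # Kinv (i + 1) # map F w)" and ?B = "fword (Kinv i # K (i + 1) # map F w)"
      have AB: "?A \<in> Verma_spanned lam" "?B \<in> Verma_spanned lam"
        using Verma_spanned_lgen_if[OF K Ki, of i "i + 1" w] Verma_spanned_lgen_if[OF Ki K, of i "i + 1" w] by simp_all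
      have e: "fword (E i # F i # map F w) - (fword (F i # E i # map F w) + (sc ?s ?A + sc (- ?s) ?B))
          = fword (E i # F i # map F w) - fword (F i # E i # map F w) + (sc (- ?s) ?A + sc ?s ?B)"
        by (simp add: fun_eq_iff pw algebra_simps)
      have "fword (E i # F i # map F w) - (fword (F i # E i # map F w) + (sc ?s ?A + sc (- ?s) ?B)) \<in> Verma_ideal lam"
        unfolding e by (rule Verma_EF')
      then have "fword (E i # F i # map F w) \<in> Verma_spanned lam"
        by (rule Verma_spanned_cong) (use FE AB True in \<open>simp add: Verma_spanned_add Verma_spanned_sc\<close>)
      then show ?thesis using True by simp
    qed
  qed
  show ?thesis
    by (cases g) (simp_all add: Verma_spanned_lgen_if[OF E assms] Verma_spanned_lgen_if[OF F assms] Verma_spanned_lgen_if[OF K assms]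
        Verma_spanned_lgen_if[OF Ki assms])
qed

lemma FA_Verma_spanned: "a \<in> FA \<Longrightarrow> a \<in> Verma_spanned lam"
proof (induction a rule: FA_induct)
  case zero
  show ?case by (rule Verma_spanned_Fspan[OF Fspan_closed(3)])
next
  case (add b c u)
  have "fword u \<in> Verma_spanned lam"
  proof (induction u)
    case Nil
    show ?case using Verma_spanned_Fspan[OF Fspan_closed(4)[of "[]"]] by simp
  next
    case (Cons g u)
    then show ?case using Verma_spanned_lgen[of "fword u" lam g] by simp
  qed
  then show ?case using add by (simp add: Verma_spanned_add Verma_spanned_sc)
qed

text \<open>Recovers the indices of an \<open>F\<close>-word; being total, it allows the diagonal
  action of \<open>K_i\<close> to be written as an operator on all of \<open>falg\<close>.\<close>

fun gidx :: "gen \<Rightarrow> int" where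
  "gidx (E i) = i" | "gidx (F i) = i" | "gidx (K i) = i" | "gidx (Kinv i) = i"

lemma Fspan_lgen_K:
  assumes "b \<in> Fspan"
  shows "lgen (K i) b - (\<lambda>u. vq powi wtw lam (map gidx u) i * b u) \<in> Verma_ideal lam"
proof -
  define D where "D b = (\<lambda>u. vq powi wtw lam (map gidx u) i * b u)" for b
  have linD: "linop D" unfolding D_def by (rule linopI) (simp_all add: pw algebra_simps)
  have idx: "map gidx (map F w) = w" for w by (simp add: comp_def)
  have DF: "D (fword (map F w)) = sc (vq powi wtw lam w i) (fword (map F w))" for w
    using idx[of w] by (auto simp: D_def fun_eq_iff fword_def pw)
  have "lgen (K i) b - D b \<in> Verma_ideal lam"
    using assms
  proof (induction b rule: Fspan_induct)
    case zero
    show ?case by (simp add: falg_linear linop_simps[OF linD] Verma_closed)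
  next
    case (add b c w)
    have "(lgen (K i) b - D b)
        + sc c (fword (K i # map F w) - sc (vq powi wtw lam w i) (fword (map F w))) \<in> Verma_ideal lam"
      by (intro Verma_closed(3,4) Verma_K add)
    then show ?case
      by (simp add: falg_linear linop_simps[OF linD] DF sc_distrib algebra_simps)
  qed
  then show ?thesis by (simp add: D_def)
qed

text \<open>Weight vectors for different weights are separated by the operators \<open>K_i - v^m\<close>; this
  removes the nonempty words from \<open>b\<close> one at a time.\<close>
lemma Fspan_kill:
  assumes J: "is_lideal J" "Verma_ideal lam \<subseteq> J"
    and "b \<in> Fspan" "b \<in> J" "b [] \<noteq> 0"
  shows "fword [] \<in> J"
  using assms(3-5)
proof (induction "card {u. b u \<noteq> 0}" arbitrary: b rule: less_induct)
  case less
  note cl = lideal_closed[OF J(1)]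
  have fin: "finite {u. b u \<noteq> 0}" using Fspan_FA[OF less.prems(1)] by (simp add: FA_def)
  show ?case
  proof (cases "\<exists>u. b u \<noteq> 0 \<and> u \<noteq> []")
    case False
    then have "b = sc (b []) (fword [])" by (auto simp: fun_eq_iff fword_def pw)
    then have "sc (inverse (b [])) b = fword []"
      using less.prems(3) by (metis left_inverse sc_simps(1,4))
    then show ?thesis using cl(4)[OF less.prems(2)] by metis
  next
    case True
    then obtain w where w: "b (map F w) \<noteq> 0" "w \<noteq> []"
      using less.prems(1) by (auto simp: Fspan_def)
    obtain i where i: "wtw lam w i \<noteq> lam i" using wtw_neq_Nil[OF w(2)] by blast
    let ?D = "\<lambda>u. vq powi wtw lam (map gidx u) i * b u"
    \<comment> \<open>Modulo the Verma ideal this is \<open>(K_i - v^m) b\<close>, where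
      \<open>m\<close> is the coordinate of the weight of \<open>w\<close> at \<open>i\<close>. The
      coefficient at \<open>map F w\<close> disappears, while the one at the empty word is
      multiplied by a nonzero scalar by the choice of \<open>i\<close>.\<close>
    let ?b = "?D - sc (vq powi wtw lam w i) b"
    have idx: "map gidx (map F w) = w" by (simp add: comp_def)
    have eq: "?b u = (vq powi wtw lam (map gidx u) i - vq powi wtw lam w i) * b u" for u
      by (simp add: pw algebra_simps)
    have "lgen (K i) b - (lgen (K i) b - ?D) \<in> J"
      using lideal_diff[OF J(1) cl(5)[OF less.prems(2)]] Fspan_lgen_K[OF less.prems(1)] J(2) by blast
    then have bJ: "?b \<in> J" using lideal_diff[OF J(1) _ cl(4)[OF less.prems(2)]] by simp
    have sub: "{u. ?b u \<noteq> 0} \<subseteq> {u. b u \<noteq> 0} - {map F w}"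
      unfolding eq using idx by auto
    have "?b \<in> Fspan" using bJ cl(1) sub less.prems(1) by (auto simp: Fspan_def)
    moreover have "?b [] \<noteq> 0" unfolding eq using i less.prems(3) by simp
    moreover have "card {u. ?b u \<noteq> 0} < card {u. b u \<noteq> 0}"
      using sub w(1) fin by (intro psubset_card_mono) auto
    ultimately show ?thesis using less.hyps bJ by blast
  qed
qed

text \<open>Every value of \<open>opF\<close> vanishes at the empty word, so only the empty
  \<open>F\<close>-word contributes there.\<close>

lemma ev_wordmod_Fspan_Nil: "b \<in> Fspan \<Longrightarrow> ev (wordmod lam) eps b [] = b []"
proof (induction b rule: Fspan_induct)
  case (add b c w)
  have "acts (wordmod lam) (map F w) eps [] = fword (map F w) []"
    by (cases w) (auto simp: eps_def fword_def)
  then have "ev (wordmod lam) eps (b + sc c (fword (map F w))) [] = (b + sc c (fword (map F w))) []"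
    using add by (simp add: Om.eps FA_sc pw)
  then show ?case .
next
  case zero
  have "ev (wordmod lam) eps 0 [] = (0 :: falg) []" by (simp add: pw)
  then show ?case .
qed

text \<open>If \<open>ev (wordmod lam) eps a\<close> did not vanish at the empty word, an
  \<open>F\<close>-word representative of \<open>a\<close> would lie in \<open>J\<close> with
  nonzero constant coefficient, and \<open>Fspan_kill\<close> would put 1 into \<open>J\<close>. As
  \<open>J\<close> is a left ideal, this applies to all \<open>E\<close>-translates of
  \<open>a\<close>, one of which exposes a multiple of \<open>eps\<close> whenever the value is not
  0.\<close>

lemma proper_lideal_subset:
  assumes J: "is_lideal J" "Verma_ideal lam \<subseteq> J" "fone \<notin> J"
  shows "J \<subseteq> wordmod.ann lam eps"
proof
  fix a assume a: "a \<in> J"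
  note cl = lideal_closed[OF J(1)]
  have Nil: "ev (wordmod lam) eps a [] = 0" if a: "a \<in> J" for a
  proof (rule ccontr)
    assume ne: "ev (wordmod lam) eps a [] \<noteq> 0"
    obtain b where b: "b \<in> Fspan" "a - b \<in> Verma_ideal lam"
      using FA_Verma_spanned[OF cl(1)[OF a]] by (auto simp: Verma_spanned_def)
    have "a - b \<in> wordmod.ann lam eps"
      using wordmod.Verma_ideal_ann[OF eps_wspace, of lam] b(2) by auto
    then have "ev (wordmod lam) eps a = ev (wordmod lam) eps b"
      using wordmod.ev_diff_eq_zero_iff[of a b eps lam] cl(1)[OF a] Fspan_FA[OF b(1)]
      by (simp add: wordmod.ann_def Om.eps)
    then have "b [] \<noteq> 0" using ev_wordmod_Fspan_Nil[OF b(1), of lam] ne by simp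
    moreover have "b \<in> J" using lideal_diff[OF J(1) a, of "a - b"] b(2) J(2) by auto
    ultimately show False using Fspan_kill[OF J(1,2) b(1)] J(3) by (simp add: falg_ops)
  qed
  have "ev (wordmod lam) eps a = 0"
  proof (rule ccontr)
    assume ne: "ev (wordmod lam) eps a \<noteq> 0"
    have "ev (wordmod lam) eps a \<in> Om lam" using wordmod.ev_closed[of eps lam a] Om.eps by simp
    from acts_E_eq_eps[OF this ne] obtain u c
      where c: "c \<noteq> 0" "acts (wordmod lam) (map E u) (ev (wordmod lam) eps a) = sc c eps" by metis
    \<comment> \<open>\<open>foldr lgen v a\<close> is the product of the word \<open>v\<close> with
      \<open>a\<close>, which stays in \<open>J\<close>.\<close>
    have "foldr lgen v a \<in> J \<and> ev (wordmod lam) eps (foldr lgen v a) = acts (wordmod lam) v (ev (wordmod lam) eps a)" for v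
    proof (induction v)
      case (Cons g v)
      then show ?case using cl(1,5) wordmod.ev_lgen[of "foldr lgen v a" eps lam g] by (simp add: Om.eps)
    qed (simp add: a)
    from this[of "map E u"] Nil c(2) have "sc c eps [] = 0" by metis
    then show False using c(1) by (simp add: pw eps_def)
  qed
  then show "a \<in> wordmod.ann lam eps" using cl(1)[OF a] by (simp add: wordmod.ann_def)
qed

lemma fone_notin_ann: "fone \<notin> wordmod.ann lam eps"
  by (simp add: falg_ops wordmod.ann_def Om.eps)

text \<open>The annihilator is itself a proper left ideal above the Verma ideal, and
  \<open>proper_lideal_subset\<close> makes it the largest one.\<close>

lemma Max_ideal_eq: "Max_ideal lam = wordmod.ann lam eps"
proof -
  have ann: "is_lideal (wordmod.ann lam eps)" by (rule wordmod.is_lideal_ann) (simp add: Om.eps)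
  have "\<Union> {J. is_lideal J \<and> Verma_ideal lam \<subseteq> J \<and> fone \<notin> J} = wordmod.ann lam eps"
    using ann wordmod.Verma_ideal_ann[OF eps_wspace, of lam] fone_notin_ann[of lam] proper_lideal_subset[of _ lam]
    by auto
  then show ?thesis
    unfolding Max_ideal_def using lideal_least[OF ann order_refl] by (auto intro: lideal.base)
qed

section \<open>Primitive vectors\<close>

context umodule
begin

lemma acts_RELS:
  assumes "[(1, u), (- c, w)] \<in> RELS" "y \<in> carr M"
  shows "acts M u y = msmul M c (acts M w y)"
  using opr_RELS[OF assms] assms(2) add_neg_eq_zero_iff[of "acts M u y" "acts M w y" c]
  by (simp add: opr_def msum_def)

lemma wspace_carr: "y \<in> wspace M mu \<Longrightarrow> y \<in> carr M"
  by (simp add: wspace_def)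

lemma K_wspace: "y \<in> wspace M mu \<Longrightarrow> mact M (K i) y = msmul M (vq powi mu i) y"
  by (simp add: wspace_def)

lemma Kinv_wspace:
  assumes "y \<in> wspace M mu"
  shows "mact M (Kinv i) y = msmul M (vq powi (- mu i)) y"
proof -
  have y: "y \<in> carr M" using assms by (rule wspace_carr)
  from acts_RELS[OF RELS_mem(1)[of i] y] have "msmul M (vq powi mu i) (mact M (Kinv i) y) = y"
    using y K_wspace[OF assms, of i] by simp
  then have "msmul M (inverse (vq powi mu i) * vq powi mu i) (mact M (Kinv i) y)
      = msmul M (inverse (vq powi mu i)) y"
    using y module_laws(2)[of "mact M (Kinv i) y" "inverse (vq powi mu i)" "vq powi mu i"] by simp
  then show ?thesis using y by (simp add: power_int_minus)
qed

lemma wspace_smul: "y \<in> wspace M mu \<Longrightarrow> msmul M c y \<in> wspace M mu"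
  by (simp add: wspace_def mult.commute)

lemma wspace_E:
  assumes "y \<in> wspace M mu"
  shows "mact M (E i) y \<in> wspace M (\<lambda>j. mu j + (dlt j i - dlt j (i + 1)))"
proof -
  have y: "y \<in> carr M" using assms by (rule wspace_carr)
  have "mact M (K j) (mact M (E i) y) = msmul M (vq powi (mu j + (dlt j i - dlt j (i + 1)))) (mact M (E i) y)" for j
  using acts_RELS[OF RELS_mem(2)[of j i] y]
    y by (simp add: K_wspace[OF assms] power_int_add mult.commute)
  then show ?thesis using y by (simp add: wspace_def)
qed

lemma wspace_F:
  assumes "y \<in> wspace M mu"
  shows "mact M (F i) y \<in> wspace M (\<lambda>j. mu j + (dlt j (i + 1) - dlt j i))"
proof -
  have y: "y \<in> carr M" using assms by (rule wspace_carr)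
  have "mact M (K j) (mact M (F i) y) = msmul M (vq powi (mu j + (dlt j (i + 1) - dlt j i))) (mact M (F i) y)" for j
  using acts_RELS[OF RELS_mem(3)[of j i] y]
    y by (simp add: K_wspace[OF assms] power_int_add mult.commute)
  then show ?thesis using y by (simp add: wspace_def)
qed

lemma EF_wspace:
  assumes "y \<in> wspace M mu"
  shows "mact M (E i) (mact M (F i) y)
    = madd M (mact M (F i) (mact M (E i) y)) (msmul M (qint (mu i - mu (i + 1))) y)"
proof -
  have y: "y \<in> carr M" using assms by (rule wspace_carr)
  let ?s = "inverse (vq - inverse vq)" and ?A = "mact M (E i) (mact M (F i) y)"
    and ?B = "mact M (F i) (mact M (E i) y)"
  have KK: "acts M [K i, Kinv (i + 1)] y = msmul M (vq powi (mu i - mu (i + 1))) y"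
    "acts M [Kinv i, K (i + 1)] y = msmul M (vq powi (- (mu i - mu (i + 1)))) y"
    using y by (simp_all add: K_wspace[OF assms] Kinv_wspace[OF assms] power_int_diff power_int_minus field_simps)
  have "madd M (msmul M 1 (acts M [E i, F i] y)) (madd M (msmul M (- 1) (acts M [F i, E i] y))
      (madd M (msmul M (- ?s) (acts M [K i, Kinv (i + 1)] y))
        (madd M (msmul M ?s (acts M [Kinv i, K (i + 1)] y)) (mzero M)))) = mzero M"
    using opr_RELS[OF RELS_EF y] by (simp add: opr_def msum_def del: acts_simps)
  moreover have "madd M (msmul M (- ?s) (acts M [K i, Kinv (i + 1)] y))
        (madd M (msmul M ?s (acts M [Kinv i, K (i + 1)] y)) (mzero M))
      = msmul M (- qint (mu i - mu (i + 1))) y"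
    unfolding KK using y by (simp add: qint_def algebra_simps flip: smul_add_left)
  ultimately have "madd M ?A (msmul M (- 1) (madd M ?B (msmul M (qint (mu i - mu (i + 1))) y))) = mzero M"
    using y by simp
  then show ?thesis
    using add_neg_eq_zero_iff[of ?A "madd M ?B (msmul M (qint (mu i - mu (i + 1))) y)" 1] y by simp
qed

section \<open>Primitive vectors and the quantum \<open>sl_2\<close> formula\<close>

definition primitive :: "weight \<Rightarrow> 'm \<Rightarrow> bool" where
  "primitive lam x \<longleftrightarrow> x \<in> wspace M lam \<and> x \<noteq> mzero M \<and> (\<forall>i. mact M (E i) x = mzero M)"

lemma primitiveD:
  assumes "primitive lam x"
  shows "x \<in> carr M" "x \<in> wspace M lam" "x \<noteq> mzero M" "mact M (E i) x = mzero M"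
  using assms wspace_carr by (auto simp: primitive_def)

lemma wspace_F_power:
  assumes "x \<in> wspace M lam"
  shows "acts M (replicate n (F i)) x \<in> wspace M (\<lambda>j. lam j + int n * (dlt j (i + 1) - dlt j i))"
proof (induction n)
  case (Suc n)
  then show ?case using wspace_F[OF Suc, of i] by (simp add: algebra_simps)
qed (simp add: assms)

text \<open>Moving \<open>E_i\<close> through the factors \<open>F_i\<close> gives one commutator
  per factor; the one at \<open>F_i^k x\<close> contributes \<open>[m - 2k]\<close> with
  \<open>m = lam i - lam (i + 1)\<close>, and \<open>sum_qint\<close> evaluates the sum.\<close>

lemma E_F_power:
  assumes "primitive lam x"
  shows "mact M (E i) (acts M (replicate (Suc n) (F i)) x)
    = msmul M (qint (int (Suc n)) * qint (lam i - lam (i + 1) - int n)) (acts M (replicate n (F i)) x)"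
proof -
  note x = primitiveD[OF assms]
  let ?m = "lam i - lam (i + 1)"
  have EF: "mact M (E i) (mact M (F i) (acts M (replicate n (F i)) x))
      = madd M (mact M (F i) (mact M (E i) (acts M (replicate n (F i)) x)))
          (msmul M (qint (?m - 2 * int n)) (acts M (replicate n (F i)) x))" for n
  proof -
    have "lam i + int n * (dlt i (i + 1) - dlt i i) - (lam (i + 1) + int n * (dlt (i + 1) (i + 1) - dlt (i + 1) i))
        = ?m - 2 * int n" by simp
    then show ?thesis using EF_wspace[OF wspace_F_power[OF x(2), of n i], of i] by simp
  qed
  have "mact M (E i) (acts M (replicate (Suc n) (F i)) x)
      = msmul M (\<Sum>k<Suc n. qint (?m - 2 * int k)) (acts M (replicate n (F i)) x)"
  proof (induction n)
    case 0
    show ?case using EF[of 0] x by simp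
  next
    case (Suc n)
    have "mact M (E i) (acts M (replicate (Suc (Suc n)) (F i)) x)
        = madd M (mact M (F i) (msmul M (\<Sum>k<Suc n. qint (?m - 2 * int k)) (acts M (replicate n (F i)) x)))
          (msmul M (qint (?m - 2 * int (Suc n))) (acts M (replicate (Suc n) (F i)) x))"
      unfolding Suc[symmetric] using EF[of "Suc n"] by simp
    also have "\<dots> = msmul M (\<Sum>k<Suc (Suc n). qint (?m - 2 * int k)) (acts M (replicate (Suc n) (F i)) x)"
      using x(1) smul_add_left[of "acts M (replicate (Suc n) (F i)) x" "\<Sum>k<Suc n. qint (?m - 2 * int k)"
          "qint (?m - 2 * int (Suc n))"] by simp
    finally show ?case .
  qed
  \<comment> \<open>\<open>sum_qint\<close> is applied at \<open>Suc n\<close>, which shifts its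
    second factor.\<close>
  moreover have "?m - int (Suc n) + 1 = ?m - int n" by simp
  ultimately show ?thesis by (simp only: sum_qint)
qed

text \<open>Let \<open>k + 1\<close> be the least exponent with \<open>F_i^(k+1) x = 0\<close>; it
  is positive since \<open>x\<close> is not zero. Applying \<open>E_i\<close> gives
  \<open>[k+1] [m - k] = 0\<close>, so that \<open>m = lam i - lam (i + 1)\<close> equals
  \<open>k\<close>.\<close>

lemma primitive_dominant:
  assumes "primitive lam x" and "acts M (replicate n (F i)) x = mzero M"
  shows "lam (i + 1) \<le> lam i"
proof -
  note x = primitiveD[OF assms(1)]
  let ?P = "\<lambda>n. acts M (replicate n (F i)) x = mzero M"
  have P: "?P (LEAST n. ?P n)" by (rule LeastI[of ?P, OF assms(2)])
  then obtain k where k: "(LEAST n. ?P n) = Suc k"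
    using x(3) by (cases "LEAST n. ?P n") auto
  then have nk: "\<not> ?P k" using not_less_Least[of k ?P] by simp
  have "qint (int (Suc k)) * qint (lam i - lam (i + 1) - int k) = 0"
  proof -
    have "msmul M (qint (int (Suc k)) * qint (lam i - lam (i + 1) - int k)) (acts M (replicate k (F i)) x) = mzero M"
      using E_F_power[OF assms(1), of i k] P[unfolded k] act_zero by metis
    then show ?thesis using nk x(1) smul_eq_zero_iff[of "acts M (replicate k (F i)) x"] by blast
  qed
  then have "lam i - lam (i + 1) = int k" by simp
  then show ?thesis by simp
qed

lemma wspace_E_word:
  assumes "y \<in> wspace M mu"
  shows "acts M (map E v) y \<in> wspace M (\<lambda>j. mu j + (int (count_list v j) - int (count_list v (j - 1))))"
proof (induction v)
  case (Cons i v)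
  have "(\<lambda>j. mu j + (int (count_list v j) - int (count_list v (j - 1))) + (dlt j i - dlt j (i + 1)))
      = (\<lambda>j. mu j + (int (count_list (i # v) j) - int (count_list (i # v) (j - 1))))"
    by (auto simp: fun_eq_iff dlt_def)
  then show ?case using wspace_E[OF Cons, of i] by simp
qed (simp add: assms)

text \<open>Take the least \<open>k + 1\<close> such that all \<open>E\<close>-words of at least
  that length kill \<open>y\<close>. Some \<open>E\<close>-word of length at least \<open>k\<close>
  does not kill \<open>y\<close>, and what it produces is killed by every
  \<open>E_i\<close>.\<close>

lemma primitive_exists:
  assumes y: "y \<in> wspace M mu" "y \<noteq> mzero M"
    and n0: "\<And>v. length v \<ge> n0 \<Longrightarrow> acts M (map E v) y = mzero M"
  shows "\<exists>lam x. primitive lam x"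
proof -
  let ?P = "\<lambda>n. \<forall>v. length v \<ge> n \<longrightarrow> acts M (map E v) y = mzero M"
  have P: "?P (LEAST n. ?P n)" by (rule LeastI[of ?P n0]) (use n0 in blast)
  then have "(LEAST n. ?P n) \<noteq> 0" using y(2) by (metis acts_simps(1) list.map(1) le0)
  then obtain k where k: "(LEAST n. ?P n) = Suc k" using not0_implies_Suc by blast
  then have "\<not> ?P k" using not_less_Least[of k ?P] by simp
  then obtain v where v: "length v \<ge> k" "acts M (map E v) y \<noteq> mzero M" by blast
  have "mact M (E i) (acts M (map E v) y) = mzero M" for i
    using P[unfolded k, rule_format, of "i # v"] v(1) by simp
  then show ?thesis
    unfolding primitive_def using wspace_E_word[OF y(1)] v(2) by blast
qed

lemma weight_vector_exists:
  assumes "umod_irreducible M" "is_weight_mod M"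
  shows "\<exists>mu y. y \<in> wspace M mu \<and> y \<noteq> mzero M"
proof -
  obtain x where x: "x \<in> carr M" "x \<noteq> mzero M"
    using assms(1) closed(1) by (auto simp: umod_irreducible_def)
  then obtain ps where ps: "\<forall>(lam, y)\<in>set ps. y \<in> wspace M lam" "x = msum M (map snd ps)"
    using assms(2) by (auto simp: is_weight_mod_def)
  have "msum M (map snd ps) = mzero M" if "\<forall>(lam, y)\<in>set ps. y = mzero M" for ps :: "(weight \<times> 'm) list"
    using that by (induction ps) (auto simp: msum_def)
  from this[of ps] have "\<not> (\<forall>(lam, y)\<in>set ps. y = mzero M)" using ps(2) x(2) by blast
  then obtain lam y where "(lam, y) \<in> set ps" "y \<noteq> mzero M" by auto
  then show ?thesis using ps(1) by blast
qed

lemma is_submod_ev_image: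
  assumes "is_lideal J" "x \<in> carr M"
  shows "is_submod M (ev M x ` J)"
proof -
  note cl = lideal_closed[OF assms(1)]
  show ?thesis unfolding is_submod_def
  proof (intro conjI ballI allI)
    show "ev M x ` J \<subseteq> carr M" using assms(2) by auto
    show "mzero M \<in> ev M x ` J" using cl(2) ev_0[of x] by (metis image_eqI)
    show "madd M y z \<in> ev M x ` J" if yz: "y \<in> ev M x ` J" "z \<in> ev M x ` J" for y z
    proof -
      obtain a b where "a \<in> J" "b \<in> J" "y = ev M x a" "z = ev M x b" using yz by blast
      then show ?thesis using cl(1,3) assms(2) by (intro image_eqI[of _ _ "a + b"]) simp_all
    qed
    show "msmul M c y \<in> ev M x ` J" if "y \<in> ev M x ` J" for c y
      using that cl(1,4) assms(2) by (auto intro!: image_eqI[of _ _ "sc c _"])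
    show "mact M g y \<in> ev M x ` J" if "y \<in> ev M x ` J" for g y
      using that cl(1,5) assms(2) by (auto intro!: image_eqI[of _ _ "lgen g _"])
  qed
qed

lemma is_lideal_FA: "is_lideal FA"
  by (auto simp: is_lideal_def falg_ops FA_add FA_sc FA_lgen)

section \<open>Irreducible modules with a primitive vector as quotients of the free algebra\<close>

context
  fixes lam x
  assumes irred: "umod_irreducible M" and prim: "primitive lam x"
begin

text \<open>The image is a submodule that contains the nonzero vector \<open>x\<close>.\<close>

lemma ev_surj: "ev M x ` FA = carr M"
proof -
  note x = primitiveD[OF prim]
  have "x \<in> ev M x ` FA" using x(1) by (intro image_eqI[of _ _ "fword []"]) simp_all
  then show ?thesis
    using is_submod_ev_image[OF is_lideal_FA x(1)] irred x(3) unfolding umod_irreducible_def by blast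
qed

text \<open>One inclusion is \<open>proper_lideal_subset\<close>. For the other, the image of
  \<open>Max_ideal lam\<close> is a submodule; if it were all of \<open>M\<close>, some
  \<open>a\<close> in the ideal would satisfy \<open>a x = x\<close>, and then \<open>1 - a\<close>
  and hence 1 would lie in the ideal. So the image is zero by irreducibility.\<close>

lemma ann_primitive: "ann x = Max_ideal lam"
proof
  note x = primitiveD[OF prim]
  have fone: "fone \<notin> ann x" using x by (simp add: ann_def falg_ops)
  show sub: "ann x \<subseteq> Max_ideal lam"
    unfolding Max_ideal_eq
    by (rule proper_lideal_subset[OF is_lideal_ann[OF x(1)] Verma_ideal_ann[OF x(2,4)] fone])
  have Max: "is_lideal (Max_ideal lam)"
    unfolding Max_ideal_eq by (rule wordmod.is_lideal_ann) (simp add: Om.eps)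
  have "ev M x ` Max_ideal lam \<noteq> carr M"
  proof
    assume "ev M x ` Max_ideal lam = carr M"
    then obtain a where a: "a \<in> Max_ideal lam" "ev M x a = x" using x(1) by (metis image_iff)
    have "a \<in> FA" using lideal_closed(1)[OF Max a(1)] .
    then have "fword [] - a \<in> ann x" using a(2) x(1) by (simp add: ann_def FA_diff)
    then have "fword [] - a + a \<in> Max_ideal lam" using sub a(1) lideal_closed(3)[OF Max] by blast
    then show False using fone_notin_ann[of lam] by (simp add: Max_ideal_eq falg_ops)
  qed
  then have "ev M x ` Max_ideal lam = {mzero M}"
    using is_submod_ev_image[OF Max x(1)] irred unfolding umod_irreducible_def by blast
  then show "Max_ideal lam \<subseteq> ann x"
    using lideal_closed(1)[OF Max] by (auto simp: ann_def)
qed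

text \<open>The fibre of \<open>ev M x\<close> over \<open>y\<close>. By
  \<open>ann_primitive\<close> it is a residue class modulo \<open>Max_ideal lam\<close>, so
  \<open>coset\<close> inverts the isomorphism that takes the class of \<open>a\<close> to
  \<open>a x\<close>.\<close>

definition coset :: "'m \<Rightarrow> falg set" where
  "coset y = {a \<in> FA. ev M x a = y}"

lemma coset_nonempty: "y \<in> carr M \<Longrightarrow> \<exists>a. a \<in> coset y"
  unfolding ev_surj[symmetric] by (auto simp: coset_def)

text \<open>\<open>Lmod\<close> defines its operations by the existence of representatives. Cosets
  are nonempty and \<open>ev M x\<close> is constant on each, so the result does not depend on the
  representative.\<close>

lemma Lmod_simps:
  "carr (Lmod lam) = coset ` carr M"
  "mzero (Lmod lam) = coset (mzero M)"
  "y \<in> carr M \<Longrightarrow> z \<in> carr M \<Longrightarrow> madd (Lmod lam) (coset y) (coset z) = coset (madd M y z)"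
  "y \<in> carr M \<Longrightarrow> msmul (Lmod lam) c (coset y) = coset (msmul M c y)"
  "y \<in> carr M \<Longrightarrow> mact (Lmod lam) g (coset y) = coset (mact M g y)"
proof -
  have x: "x \<in> carr M" by (rule primitiveD(1)[OF prim])
  have N: "fsub b a \<in> Max_ideal lam \<longleftrightarrow> ev M x b = ev M x a" if "a \<in> FA" "b \<in> FA" for a b
    unfolding ann_primitive[symmetric] using that x by (auto simp: ann_def falg_ops)
  have cl: "{b \<in> FA. fsub b a \<in> Max_ideal lam} = coset (ev M x a)" if "a \<in> FA" for a
    using that N by (auto simp: coset_def)
  have "carr (Lmod lam) = (\<lambda>a. coset (ev M x a)) ` FA"
    unfolding Lmod_def Let_def by (simp add: cl cong: image_cong)
  also have "\<dots> = coset ` carr M" unfolding ev_surj[symmetric] by (simp add: image_image)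
  finally show "carr (Lmod lam) = coset ` carr M" .
  show "mzero (Lmod lam) = coset (mzero M)"
    unfolding Lmod_def Let_def using cl[of fzero] by (simp add: falg_ops)
  show "madd (Lmod lam) (coset y) (coset z) = coset (madd M y z)" if yz: "y \<in> carr M" "z \<in> carr M"
  proof -
    have "fsub w (fadd a b) \<in> Max_ideal lam \<longleftrightarrow> ev M x w = madd M y z"
      if "w \<in> FA" "a \<in> coset y" "b \<in> coset z" for w a b
      using N[of "a + b" w] that x by (auto simp: coset_def falg_ops FA_add)
    then have "{w \<in> FA. \<exists>a\<in>coset y. \<exists>b\<in>coset z. fsub w (fadd a b) \<in> Max_ideal lam}
        = {w \<in> FA. ev M x w = madd M y z}"
      using coset_nonempty[OF yz(1)] coset_nonempty[OF yz(2)] by blast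
    then show ?thesis by (simp add: Lmod_def Let_def coset_def)
  qed
  show "msmul (Lmod lam) c (coset y) = coset (msmul M c y)" if y: "y \<in> carr M"
  proof -
    have "fsub w (fsmul c a) \<in> Max_ideal lam \<longleftrightarrow> ev M x w = msmul M c y"
      if "w \<in> FA" "a \<in> coset y" for w a
      using N[of "sc c a" w] that x by (auto simp: coset_def falg_ops FA_sc)
    then have "{w \<in> FA. \<exists>a\<in>coset y. fsub w (fsmul c a) \<in> Max_ideal lam}
        = {w \<in> FA. ev M x w = msmul M c y}"
      using coset_nonempty[OF y] by blast
    then show ?thesis by (simp add: Lmod_def Let_def coset_def)
  qed
  show "mact (Lmod lam) g (coset y) = coset (mact M g y)" if y: "y \<in> carr M"
  proof -
    have "fsub w (lgen g a) \<in> Max_ideal lam \<longleftrightarrow> ev M x w = mact M g y"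
      if "w \<in> FA" "a \<in> coset y" for w a
      using N[of "lgen g a" w] that x by (auto simp: coset_def falg_ops FA_lgen)
    then have "{w \<in> FA. \<exists>a\<in>coset y. fsub w (lgen g a) \<in> Max_ideal lam}
        = {w \<in> FA. ev M x w = mact M g y}"
      using coset_nonempty[OF y] by blast
    then show ?thesis by (simp add: Lmod_def Let_def coset_def)
  qed
qed

lemma bij_coset: "bij_betw coset (carr M) (carr (Lmod lam))"
proof -
  have "inj_on coset (carr M)"
  proof (rule inj_onI)
    fix y z assume "y \<in> carr M" "coset y = coset z"
    moreover obtain a where "a \<in> coset y" using coset_nonempty \<open>y \<in> carr M\<close> by blast
    ultimately have "a \<in> coset y" "a \<in> coset z" by auto
    then show "y = z" by (simp add: coset_def)
  qed
  then show ?thesis by (simp add: bij_betw_def Lmod_simps(1))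
qed

lemma umod_iso_Lmod: "umod_iso M (Lmod lam)"
  unfolding umod_iso_def using bij_coset Lmod_simps(3-5) by (intro exI[of _ coset]) simp

end

end

section \<open>Integrability and weight spaces of the model\<close>

lemma acts_F_power: "acts (wordmod lam) (replicate n (F i)) f = (opF lam i ^^ n) f"
  by (induction n) simp_all

lemma primitive_eps: "wordmod.primitive lam lam eps"
  using eps_wspace by (simp add: wordmod.primitive_def)

lemma linop_opF_power: "linop (opF lam i ^^ n)"
  by (induction n) (simp_all add: linop_def op_linear)

text \<open>For this exponent \<open>E_F_power\<close> contains the factor \<open>[0]\<close>, so
  \<open>opE i\<close> kills the vector; the other \<open>opE j\<close> commute with
  \<open>opF lam i\<close> and kill \<open>eps\<close>. A function killed by all \<open>opE\<close>
  that vanishes at the empty word is 0.\<close>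

lemma opF_power_eps:
  assumes "lam \<in> Xplus"
  shows "(opF lam i ^^ Suc (nat (lam i - lam (i + 1)))) eps = 0"
proof -
  let ?n = "nat (lam i - lam (i + 1))"
  let ?f = "(opF lam i ^^ Suc ?n) eps"
  have dom: "lam (i + 1) \<le> lam i" using assms by (simp add: Xplus_def)
  have "opE i ?f = 0"
    using wordmod.E_F_power[OF primitive_eps, where i = i and n = ?n and lam = lam]
    unfolding acts_F_power by (simp add: dom del: funpow.simps)
  moreover have "opE j ((opF lam i ^^ m) eps) = 0" if "j \<noteq> i" for j m
    by (induction m) (use that in \<open>simp_all add: opE_opF op_linear\<close>)
  ultimately have E: "opE j ?f = 0" for j by (cases "j = i") blast+
  show ?thesis
  proof (rule ext)
    fix w show "?f w = 0 w"
    proof (cases w)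
      case (Cons j v)
      then show ?thesis using E[of j] by (simp add: opE_def fun_eq_iff pw)
    qed (simp add: pw)
  qed
qed

text \<open>By the Serre relation at most one \<open>F_i\<close> need stay to the left of
  \<open>F_j\<close>. Applying a further \<open>F_i\<close> and reducing \<open>F_i F_i F_j\<close>
  sends \<open>(a, b)\<close> to \<open>(a (v + v^(-1)) + b, - a)\<close>.\<close>

lemma opF_power_adjacent:
  assumes "\<bar>i - j\<bar> = 1"
  shows "\<exists>a b. \<forall>f. (opF lam i ^^ Suc n) (opF lam j f)
    = sc a (opF lam i (opF lam j ((opF lam i ^^ n) f))) + sc b (opF lam j ((opF lam i ^^ Suc n) f))"
proof (induction n)
  case 0
  have "opF lam i (opF lam j f) = sc 1 (opF lam i (opF lam j f)) + sc 0 (opF lam j (opF lam i f))" for f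
    by simp
  then show ?case by (metis funpow_0 funpow_simps_right(2) funpow.simps comp_apply id_apply)
next
  case (Suc n)
  then obtain a b where ab: "\<And>f. (opF lam i ^^ Suc n) (opF lam j f)
    = sc a (opF lam i (opF lam j ((opF lam i ^^ n) f))) + sc b (opF lam j ((opF lam i ^^ Suc n) f))" by blast
  have serre: "opF lam i (opF lam i (opF lam j g)) = sc (vq + inverse vq) (opF lam i (opF lam j (opF lam i g)))
      - opF lam j (opF lam i (opF lam i g))" for g
    using serre_opF[OF assms, of lam g] by (simp add: serre_def fun_eq_iff pw algebra_simps)
  have "(opF lam i ^^ Suc (Suc n)) (opF lam j f)
      = sc (a * (vq + inverse vq) + b) (opF lam i (opF lam j ((opF lam i ^^ Suc n) f)))
        + sc (- a) (opF lam j ((opF lam i ^^ Suc (Suc n)) f))" for f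
  proof -
    have "(opF lam i ^^ Suc (Suc n)) (opF lam j f) = opF lam i ((opF lam i ^^ Suc n) (opF lam j f))"
      by simp
    also have "\<dots> = sc a (opF lam i (opF lam i (opF lam j ((opF lam i ^^ n) f))))
        + sc b (opF lam i (opF lam j ((opF lam i ^^ Suc n) f)))"
      unfolding ab by (simp only: op_linear)
    also have "\<dots> = sc (a * (vq + inverse vq) + b) (opF lam i (opF lam j ((opF lam i ^^ Suc n) f)))
        + sc (- a) (opF lam j ((opF lam i ^^ Suc (Suc n)) f))"
      unfolding serre by (simp add: fun_eq_iff pw algebra_simps)
    finally show ?thesis .
  qed
  then show ?case by blast
qed

text \<open>Nilpotency starts at \<open>eps\<close> and survives each step that generates
  \<open>Om\<close>: \<open>opF lam j\<close> commutes with \<open>opF lam i\<close> unless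
  \<open>i\<close> and \<open>j\<close> are adjacent, and then \<open>opF_power_adjacent\<close>
  costs one more power.\<close>

lemma opF_locally_nilpotent:
  assumes "lam \<in> Xplus" "f \<in> Om lam"
  shows "\<exists>n0. \<forall>n\<ge>n0. (opF lam i ^^ n) f = 0"
proof -
  \<comment> \<open>A single vanishing power suffices, as all higher powers then vanish.\<close>
  have up: "\<exists>n0. \<forall>n\<ge>n0. (opF lam i ^^ n) f = 0" if "(opF lam i ^^ m) f = 0" for m f
  proof -
    have "(opF lam i ^^ (k + m)) f = 0" for k
      using that linop_0[OF linop_opF_power[where n = k and lam = lam and i = i]] by (simp add: funpow_add)
    then show ?thesis by (metis le_add_diff_inverse2)
  qed
  show ?thesis
    using assms(2)
  proof (induction rule: Om.induct)
    case eps
    show ?case using up[OF opF_power_eps[OF assms(1)]] .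
  next
    case (add f g)
    then obtain m n where "\<forall>k\<ge>m. (opF lam i ^^ k) f = 0" "\<forall>k\<ge>n. (opF lam i ^^ k) g = 0" by blast
    then have "(opF lam i ^^ (m + n)) (f + g) = 0"
      by (simp add: linop_simps[OF linop_opF_power])
    from up[OF this] show ?case .
  next
    case (sc f c)
    then obtain n where "(opF lam i ^^ n) f = 0" by blast
    then have "(opF lam i ^^ n) (sc c f) = 0" by (simp add: linop_simps[OF linop_opF_power])
    from up[OF this] show ?case .
  next
    case (opF f j)
    then obtain n where n: "\<And>k. k \<ge> n \<Longrightarrow> (opF lam i ^^ k) f = 0" by blast
    show ?case
    proof (cases "\<bar>i - j\<bar> = 1")
      case True
      obtain a b where "(opF lam i ^^ Suc n) (opF lam j f)
          = sc a (opF lam i (opF lam j ((opF lam i ^^ n) f))) + sc b (opF lam j ((opF lam i ^^ Suc n) f))"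
        using opF_power_adjacent[OF True, where lam = lam and n = n] by blast
      then have "(opF lam i ^^ Suc n) (opF lam j f) = 0"
        unfolding n[OF le_refl] n[OF le_SucI[OF le_refl]] by (simp only: op_linear sc_simps(3) add_0)
      from up[OF this] show ?thesis .
    next
      case False
      have comm: "opF lam i (opF lam j g) = opF lam j (opF lam i g)" for g
      proof (cases "i = j")
        case False
        with \<open>\<bar>i - j\<bar> \<noteq> 1\<close> have "\<bar>i - j\<bar> > 1" by linarith
        then show ?thesis by (rule opF_commute)
      qed simp
      have "(opF lam i ^^ m) (opF lam j f) = opF lam j ((opF lam i ^^ m) f)" for m
        by (induction m) (simp_all add: comm)
      then have "(opF lam i ^^ n) (opF lam j f) = 0" using n[of n] by (simp add: op_linear)
      from up[OF this] show ?thesis .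
    qed
  qed
qed

section \<open>Weight decomposition and membership in the categories\<close>

lemma is_weight_mod_wordmod: "is_weight_mod (wordmod lam)"
proof -
  have ms: "msum (wordmod lam) xs = sum_list xs" for xs
    by (induction xs) (simp_all add: msum_def)
  have "\<exists>ps :: (weight \<times> (int list \<Rightarrow> qv)) list.
      (\<forall>(mu, y)\<in>set ps. y \<in> wspace (wordmod lam) mu) \<and> f = sum_list (map snd ps)" if "f \<in> Om lam" for f
    using that
  proof (induction rule: Om.induct)
    case eps
    show ?case by (rule exI[of _ "[(lam, eps)]"]) (simp add: eps_wspace)
  next
    case (add f g)
    then obtain ps qs :: "(weight \<times> (int list \<Rightarrow> qv)) list"
      where "\<forall>(mu, y)\<in>set ps. y \<in> wspace (wordmod lam) mu" "f = sum_list (map snd ps)"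
        "\<forall>(mu, y)\<in>set qs. y \<in> wspace (wordmod lam) mu" "g = sum_list (map snd qs)" by blast
    then show ?case by (intro exI[of _ "ps @ qs"]) auto
  next
    case (sc f c)
    then obtain ps :: "(weight \<times> (int list \<Rightarrow> qv)) list"
      where ps: "\<forall>(mu, y)\<in>set ps. y \<in> wspace (wordmod lam) mu" "f = sum_list (map snd ps)" by blast
    have "sc c (sum_list (map snd ps)) = sum_list (map snd (map (apsnd (sc c)) ps))"
      for ps :: "(weight \<times> (int list \<Rightarrow> qv)) list"
      by (induction ps) (simp_all add: sc_distrib)
    moreover have "\<forall>(mu, y)\<in>set (map (apsnd (sc c)) ps). y \<in> wspace (wordmod lam) mu"
      using ps(1) wordmod.wspace_smul[of _ lam _ c] by auto
    ultimately show ?case unfolding ps(2) by blast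
  next
    case (opF f i)
    then obtain ps :: "(weight \<times> (int list \<Rightarrow> qv)) list"
      where ps: "\<forall>(mu, y)\<in>set ps. y \<in> wspace (wordmod lam) mu" "f = sum_list (map snd ps)" by blast
    let ?g = "\<lambda>(mu :: weight, y). (\<lambda>j. mu j + (dlt j (i + 1) - dlt j i), opF lam i y)"
    have "opF lam i (sum_list (map snd ps)) = sum_list (map snd (map ?g ps))"
      for ps :: "(weight \<times> (int list \<Rightarrow> qv)) list"
      by (induction ps) (auto simp: op_linear)
    moreover have "\<forall>(mu, y)\<in>set (map ?g ps). y \<in> wspace (wordmod lam) mu"
      using ps(1) wordmod.wspace_F[of _ lam _ i] by fastforce
    ultimately show ?case unfolding ps(2) by blast
  qed
  then show ?thesis unfolding is_weight_mod_def ms by simp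
qed

lemma Chi_wordmod: "Chi (wordmod lam)"
  unfolding Chi_def using is_weight_mod_wordmod E_words_vanish_wordmod by simp

lemma Cint_wordmod: assumes "lam \<in> Xplus" shows "Cint (wordmod lam)"
  unfolding Cint_def
proof (intro conjI ballI allI)
  show "is_weight_mod (wordmod lam)" by (rule is_weight_mod_wordmod)
  fix f i assume f: "f \<in> carr (wordmod lam)"
  obtain m where m: "\<forall>u. set u \<subseteq> range E \<and> length u \<ge> m \<longrightarrow> acts (wordmod lam) u f = 0"
    using E_words_vanish_wordmod[of f lam] f by auto
  obtain n where n: "\<forall>k\<ge>n. (opF lam i ^^ k) f = 0"
    using opF_locally_nilpotent[OF assms, of f i] f by auto
  have "acts (wordmod lam) (replicate k (E i)) f = mzero (wordmod lam) \<and> acts (wordmod lam) (replicate k (F i)) f = mzero (wordmod lam)"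
    if "k \<ge> max m n" for k
  proof -
    have "set (replicate k (E i)) \<subseteq> range E" by auto
    then show ?thesis using m n that by (simp add: acts_F_power)
  qed
  then show "\<exists>n0. \<forall>n\<ge>n0. acts (wordmod lam) (replicate n (E i)) f = mzero (wordmod lam) \<and>
      acts (wordmod lam) (replicate n (F i)) f = mzero (wordmod lam)" by blast
qed

text \<open>This is linear independence of the simple roots: the difference of the coefficients is
  constant in \<open>j\<close>, and it is 0 outside the two finite supports.\<close>

lemma root_coeffs_unique:
  fixes c d :: "int \<Rightarrow> nat"
  assumes "finite {i. c i \<noteq> 0}" "finite {i. d i \<noteq> 0}"
    and eq: "\<And>j. int (c j) - int (c (j - 1)) = int (d j) - int (d (j - 1))"
  shows "c = d"
proof -
  let ?D = "\<lambda>j. int (c j) - int (d j)"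
  have step: "?D j = ?D (j - 1)" for j using eq[of j] by simp
  have "infinite (UNIV - ({i. c i \<noteq> 0} \<union> {i. d i \<noteq> 0}))"
    using assms(1,2) by (simp add: infinite_UNIV_int)
  then obtain k where "k \<in> UNIV - ({i. c i \<noteq> 0} \<union> {i. d i \<noteq> 0})"
    by (metis finite.emptyI equals0I)
  then have k: "?D k = 0" by simp
  have "?D j = 0" for j
  proof (induction j rule: int_induct[where k = k])
    case base
    show ?case by (rule k)
  next
    case (step1 i)
    then show ?case using step[of "i + 1"] by simp
  next
    case (step2 i)
    then show ?case using step[of i] by simp
  qed
  then show ?thesis by (simp add: fun_eq_iff)
qed

lemma finite_count_list: "finite {i. count_list w i \<noteq> 0}"
  by (rule finite_subset[of _ "set w"]) (auto simp: count_list_0_iff)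

text \<open>The weight determines the multiplicity of every letter, so all words of weight
  \<open>mu\<close> are rearrangements of a single one.\<close>

lemma finite_words_wtw: "finite {w. wtw lam w = mu}"
proof (cases "\<exists>w0. wtw lam w0 = mu")
  case True
  then obtain w0 where w0: "wtw lam w0 = mu" ..
  have "w \<in> {w. set w \<subseteq> set w0 \<and> length w = length w0}" if "wtw lam w = mu" for w
  proof -
    have "wtw lam w j = wtw lam w0 j" for j using that w0 by simp
    then have eq: "int (count_list w j) - int (count_list w (j - 1))
        = int (count_list w0 j) - int (count_list w0 (j - 1))" for j
      unfolding wtw_count by (smt (verit))
    have c: "count_list w = count_list w0"
      by (intro root_coeffs_unique finite_count_list eq)
    then have s: "set w = set w0" by (metis count_list_0_iff subsetI subset_antisym)
    have "length w = length w0"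
      using sum_count_set[of w "set w"] sum_count_set[of w0 "set w"] c s by simp
    with s show ?thesis by simp
  qed
  then show ?thesis
    by (intro finite_subset[OF _ finite_lists_length_eq[of "set w0" "length w0"]]) auto
qed simp

lemma Om_ev: "f \<in> Om lam \<Longrightarrow> \<exists>b\<in>Fspan. ev (wordmod lam) eps b = f"
proof (induction rule: Om.induct)
  case eps
  show ?case
    using Fspan_closed(4)[of "[]"] by (intro bexI[of _ "fword []"]) (simp_all add: Om.eps)
next
  case (add f g)
  then obtain a b where "a \<in> Fspan" "b \<in> Fspan" "ev (wordmod lam) eps a = f" "ev (wordmod lam) eps b = g" by blast
  then show ?case by (intro bexI[of _ "a + b"]) (simp_all add: Fspan_closed Fspan_FA Om.eps)
next
  case (sc f c)
  then obtain a where "a \<in> Fspan" "ev (wordmod lam) eps a = f" by blast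
  then show ?case by (intro bexI[of _ "sc c a"]) (simp_all add: Fspan_closed Fspan_FA Om.eps)
next
  case (opF f i)
  then obtain a where a: "a \<in> Fspan" "ev (wordmod lam) eps a = f" by blast
  have "lgen (F i) a \<in> Fspan"
  proof -
    have "u \<in> range (map F)" if u: "lgen (F i) a u \<noteq> 0" for u
    proof -
      obtain v where v: "u = F i # v" "a v \<noteq> 0"
        using u by (auto simp: lgen_def split: list.splits if_splits)
      then obtain w where "v = map F w" using a(1) by (auto simp: Fspan_def)
      then have "u = map F (i # w)" using v(1) by simp
      then show ?thesis by blast
    qed
    then show ?thesis using FA_lgen[OF Fspan_FA[OF a(1)]] by (simp add: Fspan_def)
  qed
  then show ?case using a by (intro bexI[of _ "lgen (F i) a"]) (simp_all add: Fspan_FA Om.eps)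
qed

lemma wspace_F_word: "acts (wordmod lam) (map F w) eps \<in> wspace (wordmod lam) (wtw lam w)"
proof (induction w)
  case (Cons i w)
  have "wtw lam (i # w) = (\<lambda>j. wtw lam w j + (dlt j (i + 1) - dlt j i))" by auto
  then show ?case using wordmod.wspace_F[OF Cons, of i] by simp
qed (simp add: eps_wspace)

text \<open>\<open>pr\<close> projects onto functions supported on words of weight
  \<open>mu\<close>. It fixes or kills each \<open>F\<close>-word vector, so it turns any expression
  of \<open>f\<close> by \<open>F\<close>-words into one by those of weight
  \<open>mu\<close>.\<close>

lemma wspace_wordmod_span:
  assumes "f \<in> wspace (wordmod lam) mu"
  shows "\<exists>c. f = (\<Sum>w\<in>{w. wtw lam w = mu}. sc (c w) (acts (wordmod lam) (map F w) eps))"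
proof -
  let ?W = "{w. wtw lam w = mu}" and ?B = "\<lambda>w. acts (wordmod lam) (map F w) eps"
  define pr where "pr g = (\<lambda>w. if wtw lam w = mu then g w else 0)" for g :: "int list \<Rightarrow> qv"
  have linpr: "linop pr" unfolding pr_def by (rule linopI) (simp_all add: pw)
  have prB: "pr (?B w) = (if wtw lam w = mu then ?B w else 0)" for w
    using wspace_F_word[of lam w] by (auto simp: wspace_wordmod pr_def fun_eq_iff pw)
  have span: "\<exists>c. pr (ev (wordmod lam) eps b) = (\<Sum>w\<in>?W. sc (c w) (?B w))" if "b \<in> Fspan" for b
    using that
  proof (induction b rule: Fspan_induct)
    case zero
    show ?case by (rule exI[of _ "\<lambda>_. 0"]) (simp add: linop_simps[OF linpr])
  next
    case (add b d u)
    then obtain c where c: "pr (ev (wordmod lam) eps b) = (\<Sum>w\<in>?W. sc (c w) (?B w))" by blast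
    have "sc d (pr (?B u)) = (\<Sum>w\<in>?W. sc (if w = u then d else 0) (?B w))"
    proof -
      have "(\<Sum>w\<in>?W. sc (if w = u then d else 0) (?B w)) = (\<Sum>w\<in>?W. if w = u then sc d (?B w) else 0)"
        by (intro sum.cong) auto
      also have "\<dots> = sc d (pr (?B u))"
        by (simp add: finite_words_wtw prB)
      finally show ?thesis by simp
    qed
    then have "pr (ev (wordmod lam) eps (b + sc d (fword (map F u))))
        = (\<Sum>w\<in>?W. sc (c w + (if w = u then d else 0)) (?B w))"
      using add(1) c by (simp add: FA_sc Om.eps linop_simps[OF linpr] sc_distrib(3) sum.distrib)
    then show ?case by (rule exI[where x = "\<lambda>w. c w + (if w = u then d else 0)"])
  qed
  obtain b where b: "b \<in> Fspan" "ev (wordmod lam) eps b = f"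
    using Om_ev[of f lam] assms by (auto simp: wspace_wordmod)
  have "pr f = f" using assms by (auto simp: wspace_wordmod pr_def fun_eq_iff)
  then show ?thesis using span[OF b(1)] unfolding b(2) by simp
qed

lemma fin_dim_wordmod: "fin_dim (wordmod lam) (wspace (wordmod lam) mu)"
proof -
  obtain ws where ws: "set ws = {w. wtw lam w = mu}" "distinct ws"
    using finite_distinct_list[OF finite_words_wtw] by blast
  let ?B = "\<lambda>w. acts (wordmod lam) (map F w) eps"
  have ms: "msum (wordmod lam) xs = sum_list xs" for xs
    by (induction xs) (simp_all add: msum_def)
  have "\<exists>cs. length cs = length (map ?B ws) \<and> f = msum (wordmod lam) (map2 (msmul (wordmod lam)) cs (map ?B ws))"
    if f: "f \<in> wspace (wordmod lam) mu" for f
  proof -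
    obtain c where "f = (\<Sum>w\<in>set ws. sc (c w) (?B w))" using wspace_wordmod_span[OF f] ws(1) by auto
    also have "\<dots> = sum_list (map (\<lambda>w. sc (c w) (?B w)) ws)"
      using ws(2) by (simp add: sum_list_distinct_conv_sum_set)
    also have "map (\<lambda>w. sc (c w) (?B w)) ws = map2 sc (map c ws) (map ?B ws)"
      by (simp add: map2_map_map)
    finally show ?thesis by (intro exI[of _ "map c ws"]) (simp add: ms)
  qed
  moreover have "set (map ?B ws) \<subseteq> wspace (wordmod lam) mu" using wspace_F_word ws(1) by auto
  ultimately show ?thesis unfolding fin_dim_def by blast
qed

lemma catO_wordmod: "catO (wordmod lam)"
  unfolding catO_def
proof (intro conjI allI)
  show "is_weight_mod (wordmod lam)" by (rule is_weight_mod_wordmod)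
  show "fin_dim (wordmod lam) (wspace (wordmod lam) mu)" for mu by (rule fin_dim_wordmod)
  have "wt_le mu lam" if mu: "mu \<in> wts (wordmod lam)" for mu
  proof -
    obtain f w where "f w \<noteq> 0" "f \<in> wspace (wordmod lam) mu"
      using mu by (auto simp: wts_def fun_eq_iff pw)
    then have "wtw lam w = mu" by (auto simp: wspace_wordmod)
    then show ?thesis
      unfolding wt_le_def using finite_count_list[of w]
      by (intro exI[of _ "count_list w"]) (auto simp: wtw_count)
  qed
  then show "\<exists>ls. wts (wordmod lam) \<subseteq> {mu. \<exists>lam\<in>set ls. wt_le mu lam}"
    by (intro exI[of _ "[lam]"]) auto
qed

section \<open>The classification\<close>

text \<open>\<open>N\<close> is not assumed to be a module: its laws are carried over along
  \<open>f\<close>, which is how \<open>Lmod\<close> is shown to be one. The equations are oriented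
  so that the operations of \<open>N\<close> move inside \<open>f\<close>.\<close>

locale umod_transfer = umodule M for M :: "'m umod" +
  fixes N :: "'n umod" and f :: "'m \<Rightarrow> 'n"
  assumes bij: "bij_betw f (carr M) (carr N)"
    and zero: "f (mzero M) = mzero N"
    and add: "x \<in> carr M \<Longrightarrow> y \<in> carr M \<Longrightarrow> madd N (f x) (f y) = f (madd M x y)"
    and smul: "x \<in> carr M \<Longrightarrow> msmul N c (f x) = f (msmul M c x)"
    and act: "x \<in> carr M \<Longrightarrow> mact N g (f x) = f (mact M g x)"
begin

lemma carr_N: "carr N = f ` carr M"
  using bij by (simp add: bij_betw_def)

lemma f_inj: "x \<in> carr M \<Longrightarrow> y \<in> carr M \<Longrightarrow> f x = f y \<longleftrightarrow> x = y"
  using bij by (auto simp: bij_betw_def inj_on_eq_iff)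

lemma f_eq_zero_iff: "x \<in> carr M \<Longrightarrow> f x = mzero N \<longleftrightarrow> x = mzero M"
  using f_inj[of x "mzero M"] zero by simp

lemma acts_N: "x \<in> carr M \<Longrightarrow> acts N u (f x) = f (acts M u x)"
  by (induction u) (simp_all add: act)

lemma msum_closed: "set xs \<subseteq> carr M \<Longrightarrow> msum M xs \<in> carr M"
  by (induction xs) (simp_all add: msum_def)

lemma msum_N: "set xs \<subseteq> carr M \<Longrightarrow> msum N (map f xs) = f (msum M xs)"
proof (induction xs)
  case (Cons x xs)
  then show ?case using msum_closed[of xs] by (simp add: msum_def add)
qed (simp add: msum_def zero)

lemma opr_N:
  assumes "x \<in> carr M"
  shows "opr N r (f x) = f (opr M r x)"
proof -
  have "map (\<lambda>(c, u). msmul N c (acts N u (f x))) r = map f (map (\<lambda>(c, u). msmul M c (acts M u x)) r)"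
    using assms by (auto simp: acts_N smul)
  moreover have "set (map (\<lambda>(c, u). msmul M c (acts M u x)) r) \<subseteq> carr M" using assms by auto
  ultimately show ?thesis unfolding opr_def using msum_N by metis
qed

lemma is_umod_N: "is_umod N"
proof -
  have "\<forall>x\<in>carr M. \<exists>y\<in>carr M. f (madd M x y) = f (mzero M)" using neg_exists by metis
  then show ?thesis
    unfolding is_umod_def carr_N ball_simps bex_simps
    by (simp add: zero[symmetric] add smul act opr_N opr_RELS add_assoc smul_add_left)
      (metis add_commute)
qed

lemma wspace_N: "wspace N mu = f ` wspace M mu"
  unfolding wspace_def carr_N by (auto simp: act smul f_inj)

lemma irreducible_N:
  assumes "umod_irreducible M" shows "umod_irreducible N"
proof -
  have "S = {mzero N} \<or> S = carr N" if S: "is_submod N S" for S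
  proof -
    let ?T = "{x \<in> carr M. f x \<in> S}"
    have SfT: "S = f ` ?T" using S by (auto simp: is_submod_def carr_N)
    have "is_submod M ?T"
      using S unfolding is_submod_def
      by (auto simp: zero add[symmetric] smul[symmetric] act[symmetric])
    then have "?T = {mzero M} \<or> ?T = carr M" using assms by (auto simp: umod_irreducible_def)
    then show ?thesis using SfT zero carr_N by (elim disjE) (metis image_empty image_insert)+
  qed
  moreover have "carr N \<noteq> {mzero N}"
  proof
    assume "carr N = {mzero N}"
    then have "x = mzero M" if "x \<in> carr M" for x
      using that f_eq_zero_iff[OF that] by (auto simp: carr_N)
    then have "carr M = {mzero M}" using closed(1) by blast
    then show False using assms by (simp add: umod_irreducible_def)
  qed
  ultimately show ?thesis by (simp add: umod_irreducible_def)
qed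

lemma is_weight_mod_N:
  assumes "is_weight_mod M" shows "is_weight_mod N"
  unfolding is_weight_mod_def carr_N
proof (intro ballI, elim imageE)
  fix y x assume y: "y = f x" and x: "x \<in> carr M"
  obtain ps where ps: "\<forall>(lam, y)\<in>set ps. y \<in> wspace M lam" "x = msum M (map snd ps)"
    using assms x unfolding is_weight_mod_def by blast
  have "\<forall>(lam, y)\<in>set (map (apsnd f) ps). y \<in> wspace N lam"
    using ps(1) by (auto simp: wspace_N)
  moreover have "set (map snd ps) \<subseteq> carr M" using ps(1) wspace_carr by fastforce
  then have "y = msum N (map snd (map (apsnd f) ps))"
    using msum_N[of "map snd ps"] by (simp add: y ps(2) comp_def)
  ultimately show "\<exists>ps. (\<forall>(lam, y)\<in>set ps. y \<in> wspace N lam) \<and> y = msum N (map snd ps)" by blast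
qed

lemma Cint_N: "Cint M \<Longrightarrow> Cint N"
  unfolding Cint_def carr_N ball_simps
  using is_weight_mod_N by (simp add: acts_N f_eq_zero_iff)

lemma Chi_N: "Chi M \<Longrightarrow> Chi N"
  unfolding Chi_def carr_N ball_simps
  using is_weight_mod_N by (simp add: acts_N f_eq_zero_iff)

lemma catO_N: "catO M \<Longrightarrow> catO N"
proof -
  assume O: "catO M"
  have "fin_dim N (wspace N mu)" for mu
  proof -
    obtain bs where bs: "set bs \<subseteq> wspace M mu"
      "\<And>x. x \<in> wspace M mu \<Longrightarrow> \<exists>cs. length cs = length bs \<and> x = msum M (map2 (msmul M) cs bs)"
      using O unfolding catO_def fin_dim_def by blast
    have bsM: "set bs \<subseteq> carr M" using bs(1) wspace_carr by blast
    have "f (msum M (map2 (msmul M) cs bs)) = msum N (map2 (msmul N) cs (map f bs))" for cs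
    proof -
      have "map2 (msmul N) cs (map f bs) = map f (map2 (msmul M) cs bs)"
        using bsM by (auto simp: zip_map2 smul dest!: set_zip_rightD)
      moreover have "set (map2 (msmul M) cs bs) \<subseteq> carr M"
        using bsM by (auto dest!: set_zip_rightD)
      ultimately show ?thesis using msum_N by metis
    qed
    then have "\<exists>cs. length cs = length (map f bs) \<and> y = msum N (map2 (msmul N) cs (map f bs))"
      if "y \<in> wspace N mu" for y
      using that bs(2) unfolding wspace_N length_map by (metis imageE)
    moreover have "set (map f bs) \<subseteq> wspace N mu" using bs(1) by (auto simp: wspace_N)
    ultimately show ?thesis unfolding fin_dim_def by blast
  qed
  moreover have "wts N \<subseteq> wts M"
    unfolding wts_def wspace_N by (auto, metis zero)
  ultimately show "catO N" using O is_weight_mod_N unfolding catO_def by blast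
qed

end

lemma irreducible_coset:
  assumes "umodule M" "umod_irreducible M" "umodule.primitive M lam x"
  shows "umod_transfer M (Lmod lam) (umodule.coset M x)"
proof -
  interpret umodule M by fact
  show ?thesis
    by unfold_locales (use bij_coset[OF assms(2,3)] Lmod_simps[OF assms(2,3)] in auto)
qed

lemma wordmod_Lmod: "umod_transfer (wordmod lam) (Lmod lam) (wordmod.coset lam eps)"
  by (rule irreducible_coset[OF wordmod.umodule_axioms irreducible_wordmod primitive_eps])

section \<open>Isomorphisms and invariance of the highest weight\<close>

lemma umod_iso_sym:
  assumes "is_umod M" "umod_iso M N"
  shows "umod_iso N M"
proof -
  interpret umodule M by unfold_locales fact
  obtain f where f: "bij_betw f (carr M) (carr N)"
    "\<And>x y. x \<in> carr M \<Longrightarrow> y \<in> carr M \<Longrightarrow> f (madd M x y) = madd N (f x) (f y)"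
    "\<And>c x. x \<in> carr M \<Longrightarrow> f (msmul M c x) = msmul N c (f x)"
    "\<And>g x. x \<in> carr M \<Longrightarrow> f (mact M g x) = mact N g (f x)"
    using assms(2) unfolding umod_iso_def by blast
  let ?h = "inv_into (carr M) f"
  have h: "?h (f x) = x" if "x \<in> carr M" for x
    using f(1) that by (simp add: bij_betw_def)
  have "carr N = f ` carr M" using f(1) by (simp add: bij_betw_def)
  then show ?thesis
    unfolding umod_iso_def
    using bij_betw_inv_into[OF f(1)] by (intro exI[of _ ?h]) (auto simp: h f(2-4)[symmetric])
qed

lemma umod_iso_trans:
  assumes "umod_iso L M" "umod_iso M N"
  shows "umod_iso L N"
proof -
  obtain f where f: "bij_betw f (carr L) (carr M)"
    "\<And>x y. x \<in> carr L \<Longrightarrow> y \<in> carr L \<Longrightarrow> f (madd L x y) = madd M (f x) (f y)"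
    "\<And>c x. x \<in> carr L \<Longrightarrow> f (msmul L c x) = msmul M c (f x)"
    "\<And>g x. x \<in> carr L \<Longrightarrow> f (mact L g x) = mact M g (f x)"
    using assms(1) unfolding umod_iso_def by blast
  obtain h where h: "bij_betw h (carr M) (carr N)"
    "\<And>x y. x \<in> carr M \<Longrightarrow> y \<in> carr M \<Longrightarrow> h (madd M x y) = madd N (h x) (h y)"
    "\<And>c x. x \<in> carr M \<Longrightarrow> h (msmul M c x) = msmul N c (h x)"
    "\<And>g x. x \<in> carr M \<Longrightarrow> h (mact M g x) = mact N g (h x)"
    using assms(2) unfolding umod_iso_def by blast
  have fM: "f x \<in> carr M" if "x \<in> carr L" for x using f(1) that by (auto simp: bij_betw_def)
  show ?thesis
    unfolding umod_iso_def
    by (intro exI[of _ "h \<circ> f"]) (simp add: bij_betw_trans[OF f(1) h(1)] f h fM)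
qed

text \<open>The image of \<open>eps\<close> is nonzero and killed by all \<open>opE\<close>, hence
  supported on the empty word, where the eigenvalue of \<open>K_i\<close> is
  \<open>v^(mu i)\<close>. As the image of \<open>eps\<close> it also has the eigenvalue
  \<open>v^(lam i)\<close>.\<close>

lemma wordmod_iso_weight:
  assumes "umod_iso (wordmod lam) (wordmod mu)"
  shows "lam = mu"
proof -
  obtain h where bij: "bij_betw h (Om lam) (Om mu)"
    and sc: "\<And>c f. f \<in> Om lam \<Longrightarrow> h (sc c f) = sc c (h f)"
    and act: "\<And>g f. f \<in> Om lam \<Longrightarrow> h (act lam g f) = act mu g (h f)"
    using assms unfolding umod_iso_def by auto
  have h0: "h 0 = 0" using sc[OF Om_zero, of 0] by simp
  let ?g = "h eps"
  have "?g \<noteq> 0"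
    using bij h0 Om.eps[of lam] Om_zero[of lam] eps_nonzero unfolding bij_betw_def by (metis inj_on_eq_iff)
  have E: "opE i ?g = 0" for i using act[OF Om.eps, of "E i"] h0 by simp
  have cons: "?g (i # w) = 0" for i w
    using fun_cong[OF E[of i], of w] by (simp add: opE_def pw)
  have Nil: "?g [] \<noteq> 0"
  proof
    assume "?g [] = 0"
    then have "?g w = 0" for w by (cases w) (simp_all add: cons)
    then show False using \<open>?g \<noteq> 0\<close> by (simp add: fun_eq_iff pw)
  qed
  have "lam i = mu i" for i
  proof -
    have "opK mu i ?g = sc (vq powi lam i) ?g"
      using act[OF Om.eps, of "K i"] sc[OF Om.eps, of "vq powi lam i"] by (simp add: opK_eps)
    from fun_cong[OF this, of "[]"] show ?thesis using Nil by (simp add: opw)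
  qed
  then show ?thesis by (simp add: fun_eq_iff)
qed

text \<open>The common end of both classifications: the vanishing of long \<open>E\<close>-words
  yields a primitive vector, integrability makes its weight dominant, and irreducibility identifies
  \<open>M\<close>.\<close>

lemma irreducible_iso_Lmod:
  assumes M: "is_umod M" "umod_irreducible M" "Cint M"
    and y: "y \<in> wspace M mu" "y \<noteq> mzero M" "\<And>v. length v \<ge> n0 \<Longrightarrow> acts M (map E v) y = mzero M"
  shows "\<exists>lam\<in>Xplus. umod_iso M (Lmod lam)"
proof -
  interpret umodule M by unfold_locales (rule M(1))
  obtain lam x where x: "primitive lam x" using primitive_exists[OF y] by blast
  have "lam (i + 1) \<le> lam i" for i
  proof -
    obtain n where "acts M (replicate n (F i)) x = mzero M"
      using M(3) primitiveD(1)[OF x] unfolding Cint_def by blast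
    then show ?thesis by (rule primitive_dominant[OF x])
  qed
  then have "lam \<in> Xplus" by (simp add: Xplus_def)
  then show ?thesis using umod_iso_Lmod[OF M(2) x] by blast
qed

lemma Chi_iso_Lmod:
  assumes M: "is_umod M" "umod_irreducible M" "Cint M" "Chi M"
  shows "\<exists>lam\<in>Xplus. umod_iso M (Lmod lam)"
proof -
  interpret umodule M by unfold_locales (rule M(1))
  obtain mu y where y: "y \<in> wspace M mu" "y \<noteq> mzero M"
    using weight_vector_exists M(2,3) unfolding Cint_def by blast
  obtain n0 where n0: "\<And>u. set u \<subseteq> range E \<Longrightarrow> length u \<ge> n0 \<Longrightarrow> acts M u y = mzero M"
    using M(4) wspace_carr[OF y(1)] unfolding Chi_def by blast
  show ?thesis
    by (rule irreducible_iso_Lmod[OF M(1-3) y, of n0]) (rule n0, auto)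
qed

text \<open>The height of \<open>lam - mu\<close> bounds the number of \<open>E\<close>'s that can be applied to a vector of
  weight \<open>mu\<close> without leaving the cone below \<open>lam\<close>.\<close>
lemma wt_le_height_bound:
  "\<exists>n. \<forall>v. wt_le (\<lambda>j. mu j + (int (count_list v j) - int (count_list v (j - 1)))) lam \<longrightarrow> length v \<le> n"
proof -
  let ?wt = "\<lambda>v j. mu j + (int (count_list v j) - int (count_list v (j - 1)))"
  \<comment> \<open>Adding the letter counts of \<open>v\<close> to the coefficients of
    \<open>lam - ?wt v\<close> expresses \<open>lam - mu\<close>. By
    \<open>root_coeffs_unique\<close> the sum is the same for every \<open>v\<close>, so it bounds
    all their letter counts.\<close>
  have coeff: "\<exists>d. finite {i. d i \<noteq> 0} \<and> (\<forall>j. lam j - mu j = int (d j) - int (d (j - 1)))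
      \<and> (\<forall>i. count_list v i \<le> d i)" if v: "wt_le (?wt v) lam" for v
  proof -
    obtain c where c: "finite {i. c i \<noteq> 0}" "\<And>j. lam j - ?wt v j = int (c j) - int (c (j - 1))"
      using v unfolding wt_le_def by blast
    have "finite {i. c i + count_list v i \<noteq> 0}"
      by (rule finite_subset[OF _ finite_UnI[OF c(1) finite_count_list[of v]]]) auto
    moreover have "lam j - mu j = int (c j + count_list v j) - int (c (j - 1) + count_list v (j - 1))" for j
      using c(2)[of j] by simp
    ultimately show ?thesis by (intro exI[of _ "\<lambda>i. c i + count_list v i"]) simp
  qed
  show ?thesis
  proof (cases "\<exists>v. wt_le (?wt v) lam")
    case True
    then obtain d where d: "finite {i. d i \<noteq> 0}" "\<And>j. lam j - mu j = int (d j) - int (d (j - 1))"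
      using coeff by blast
    have "length v \<le> sum d {i. d i \<noteq> 0}" if v: "wt_le (?wt v) lam" for v
    proof -
      obtain d' where d': "finite {i. d' i \<noteq> 0}" "\<And>j. lam j - mu j = int (d' j) - int (d' (j - 1))"
        "\<And>i. count_list v i \<le> d' i" using coeff[OF v] by blast
      have "d' = d" by (rule root_coeffs_unique[OF d'(1) d(1)]) (simp flip: d(2) d'(2))
      then have le: "count_list v i \<le> d i" for i using d'(3) by simp
      have "set v \<subseteq> {i. d i \<noteq> 0}"
      proof
        fix i assume "i \<in> set v"
        then have "count_list v i \<noteq> 0" by (simp add: count_list_0_iff)
        then show "i \<in> {i. d i \<noteq> 0}" using le[of i] by simp
      qed
      then have "length v = sum (count_list v) {i. d i \<noteq> 0}" using d(1) by (simp add: sum_count_set)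
      also have "\<dots> \<le> sum d {i. d i \<noteq> 0}" by (intro sum_mono le)
      finally show ?thesis .
    qed
    then show ?thesis by blast
  qed blast
qed

lemma catO_iso_Lmod:
  assumes M: "is_umod M" "umod_irreducible M" "Cint M" "catO M"
  shows "\<exists>lam\<in>Xplus. umod_iso M (Lmod lam)"
proof -
  interpret umodule M by unfold_locales (rule M(1))
  obtain mu y where y: "y \<in> wspace M mu" "y \<noteq> mzero M"
    using weight_vector_exists M(2,3) unfolding Cint_def by blast
  obtain ls where ls: "wts M \<subseteq> {mu. \<exists>lam\<in>set ls. wt_le mu lam}"
    using M(4) unfolding catO_def by blast
  let ?wt = "\<lambda>v j. mu j + (int (count_list v j) - int (count_list v (j - 1)))"
  obtain n where n: "\<And>lam v. wt_le (?wt v) lam \<Longrightarrow> length v \<le> n lam"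
    using wt_le_height_bound[of mu] by metis
  \<comment> \<open>The sum of the bounds over the finite set of \<open>lam\<close> dominates each
    of them, so one length serves the whole union of cones.\<close>
  have "acts M (map E v) y = mzero M" if v: "length v \<ge> Suc (\<Sum>lam\<in>set ls. n lam)" for v
  proof (rule ccontr)
    assume "acts M (map E v) y \<noteq> mzero M"
    then have "?wt v \<in> wts M" using wspace_E_word[OF y(1)] unfolding wts_def by blast
    then obtain lam where "lam \<in> set ls" "wt_le (?wt v) lam" using ls by blast
    then have "length v \<le> (\<Sum>lam\<in>set ls. n lam)"
      using n member_le_sum[of lam "set ls" n] by (meson List.finite_set le_trans zero_le)
    with v show False by simp
  qed
  then show ?thesis by (rule irreducible_iso_Lmod[OF M(1-3) y])
qed

theorem theorem9p6:
  shows
   "(\<forall>lam\<in>Xplus. is_umod (Lmod lam) \<and> umod_irreducible (Lmod lam)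
        \<and> Cint (Lmod lam) \<and> Chi (Lmod lam))
  \<and> (\<forall>lam\<in>Xplus. \<forall>mu\<in>Xplus. umod_iso (Lmod lam) (Lmod mu) \<longrightarrow> lam = mu)
  \<and> (\<forall>M :: 'm umod. is_umod M \<and> umod_irreducible M \<and> Cint M \<and> Chi M
        \<longrightarrow> (\<exists>lam\<in>Xplus. umod_iso M (Lmod lam)))
  \<and> (\<forall>lam\<in>Xplus. is_umod (Lmod lam) \<and> umod_irreducible (Lmod lam)
        \<and> Cint (Lmod lam) \<and> catO (Lmod lam))
  \<and> (\<forall>M :: 'n umod. is_umod M \<and> umod_irreducible M \<and> Cint M \<and> catO M
        \<longrightarrow> (\<exists>lam\<in>Xplus. umod_iso M (Lmod lam)))"
proof -
  have L: "is_umod (Lmod lam) \<and> umod_irreducible (Lmod lam) \<and> Cint (Lmod lam) \<and> Chi (Lmod lam)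
      \<and> catO (Lmod lam)" if lam: "lam \<in> Xplus" for lam
  proof -
    interpret umod_transfer "wordmod lam" "Lmod lam" "wordmod.coset lam eps" by (rule wordmod_Lmod)
    show ?thesis
      using is_umod_N irreducible_N[OF irreducible_wordmod] Cint_N[OF Cint_wordmod[OF lam]] Chi_N[OF Chi_wordmod]
        catO_N[OF catO_wordmod] by blast
  qed
  \<comment> \<open>Isomorphisms between the \<open>Lmod\<close> are pulled back to the models,
    where the weight can be read off.\<close>
  have ShL: "umod_iso (wordmod lam) (Lmod lam)" for lam
    by (rule wordmod.umod_iso_Lmod[OF irreducible_wordmod primitive_eps])
  have inj: "lam = mu" if "umod_iso (Lmod lam) (Lmod mu)" for lam mu
    using umod_iso_trans[OF umod_iso_trans[OF ShL that] umod_iso_sym[OF is_umod_wordmod ShL]]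
    by (rule wordmod_iso_weight)
  show ?thesis using L inj Chi_iso_Lmod catO_iso_Lmod by blast
qed

end
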